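(* Let $\mathbb{K}$ be a field of characteristic zero, let $n\ge 1$, and let $I \subset \mathbb{K}[x_0,x_1,x_2,x_3]$ be the ideal of $n$ simple points in general position in $\mathbb{P}^3$. Then for every $m \geq 1$ and every $k\in\{0,1,2\}$, $$\alpha(I^{(3m-k)}) \geq m\,\alpha(I)+2m-k.$$
   Context: $\mathbb{K}[x_0,\dots,x_3]$ is the standard graded coordinate ring of $\mathbb{P}^3$ over $\mathbb{K}$. For a point $p$, $\mathfrak{m}_p$ is the homogeneous ideal generated by the forms vanishing at $p$. The ideal of simple points $p_1,\dots,p_n$ is $I=\bigcap_{j=1}^n \mathfrak{m}_{p_j}$ (all multiplicities equal to one), and its $m$-th symbolic power is $I^{(m)}=\bigcap_{j=1}^n \mathfrak{m}_{p_j}^{m}$. For a nonzero homogeneous ideal $J$, $J_t=\{f\in J: \deg f=t\}$ is the degree-$t$ part (together with $0$) and $\alpha(J)=\min\{t\ge 0: J_t\ne 0\}$. "In general position" (or "generic") is meant in the usual sense: for each given choice of the integers involved ($n$, $m$, $k$), the assertion holds for all $(p_1,\dots,p_n)$ in some nonempty Zariski-open subset of $(\mathbb{P}^3)^n$. *)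

theory Defs
  imports
    "HOL-Library.Poly_Mapping"
    "HOL-Library.Numeral_Type"
    "HOL-Analysis.Cartesian_Space"
begin

section \<open>Polynomials\<close>

type_synonym ('v, 'a) mpoly = "('v \<Rightarrow>\<^sub>0 nat) \<Rightarrow>\<^sub>0 'a"

definition poly_eval :: "('v, 'a::comm_semiring_1) mpoly \<Rightarrow> ('v \<Rightarrow> 'a) \<Rightarrow> 'a" where
  "poly_eval f x =
     (\<Sum>mon\<in>Poly_Mapping.keys f. Poly_Mapping.lookup f mon * (\<Prod>v\<in>Poly_Mapping.keys mon. x v ^ Poly_Mapping.lookup mon v))"

text \<open>The zero polynomial is homogeneous of every degree.\<close>

definition homogeneous_of_degree :: "nat \<Rightarrow> ('v, 'a::zero) mpoly \<Rightarrow> bool" where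
  "homogeneous_of_degree d f \<longleftrightarrow> (\<forall>mon\<in>Poly_Mapping.keys f. (\<Sum>v\<in>Poly_Mapping.keys mon. Poly_Mapping.lookup mon v) = d)"

definition homogeneous :: "('v, 'a::zero) mpoly \<Rightarrow> bool" where
  "homogeneous f \<longleftrightarrow> (\<exists>d. homogeneous_of_degree d f)"


section \<open>Ideals\<close>

text \<open>An ideal of a commutative ring is a submodule of the ring regarded as a module over itself.\<close>

definition ideal_generated :: "'r::comm_ring_1 set \<Rightarrow> 'r set" where
  "ideal_generated S = module.span (*) S"

fun ideal_power :: "'r::comm_ring_1 set \<Rightarrow> nat \<Rightarrow> 'r set" where
  "ideal_power J 0 = UNIV"
| "ideal_power J (Suc m) = ideal_generated {f * g | f g. f \<in> J \<and> g \<in> ideal_power J m}"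

definition graded_part :: "('v, 'a::zero) mpoly set \<Rightarrow> nat \<Rightarrow> ('v, 'a) mpoly set" where
  "graded_part J t = {f \<in> J. homogeneous_of_degree t f}"

text \<open>This is only meaningful for a nonzero homogeneous ideal.\<close>

definition initial_degree :: "('v, 'a::zero) mpoly set \<Rightarrow> nat" (\<open>\<alpha>\<close>) where
  "\<alpha> J = (LEAST t. graded_part J t \<noteq> {0})"


section \<open>Projective space and its finite powers\<close>

text \<open>Points are the lines through the origin in the space of vectors indexed by \<open>'v\<close>,
  so the points with \<open>'v = 4\<close> form projective 3-space.\<close>

definition proj_space :: "('a::field ^ 'v) set set" where
  "proj_space = {vec.span {x} | x. x \<noteq> 0}"

definition proj_tuples :: "nat \<Rightarrow> (nat \<Rightarrow> ('a::field ^ 'v) set) set" where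
  "proj_tuples n = {..<n} \<rightarrow>\<^sub>E proj_space"

text \<open>The variable \<open>(i, v)\<close> is the homogeneous coordinate \<open>v\<close> of the \<open>i\<close>-th point.\<close>

definition multihomogeneous :: "nat \<Rightarrow> (nat \<times> 'v::finite, 'a::zero) mpoly \<Rightarrow> bool" where
  "multihomogeneous n F \<longleftrightarrow>
     (\<forall>mon\<in>Poly_Mapping.keys F. Poly_Mapping.keys mon \<subseteq> {..<n} \<times> UNIV) \<and>
     (\<exists>d. \<forall>mon\<in>Poly_Mapping.keys F. \<forall>i<n. (\<Sum>v\<in>UNIV. Poly_Mapping.lookup mon (i, v)) = d i)"

text \<open>For multihomogeneous \<open>F\<close> it is equivalent to ask that \<open>F\<close> vanishes for one choice of
  nonzero representatives \<open>x i\<close> of the points \<open>p i\<close>.\<close>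

definition vanishes_at_tuple ::
    "nat \<Rightarrow> (nat \<times> 'v, 'a::field) mpoly \<Rightarrow> (nat \<Rightarrow> ('a ^ 'v) set) \<Rightarrow> bool" where
  "vanishes_at_tuple n F p \<longleftrightarrow>
     (\<forall>x. (\<forall>i<n. x i \<in> p i) \<longrightarrow> poly_eval F (\<lambda>(i, v). x i $ v) = 0)"

definition zariski_closed :: "nat \<Rightarrow> (nat \<Rightarrow> ('a::field ^ 'v::finite) set) set \<Rightarrow> bool" where
  "zariski_closed n Z \<longleftrightarrow>
     (\<exists>\<F>. (\<forall>F\<in>\<F>. multihomogeneous n F) \<and>
          Z = {p \<in> proj_tuples n. \<forall>F\<in>\<F>. vanishes_at_tuple n F p})"

definition zariski_open :: "nat \<Rightarrow> (nat \<Rightarrow> ('a::field ^ 'v::finite) set) set \<Rightarrow> bool" where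
  "zariski_open n U \<longleftrightarrow> U \<subseteq> proj_tuples n \<and> zariski_closed n (proj_tuples n - U)"


section \<open>Ideals of points\<close>

definition vanishes_at_point :: "('v, 'a::field) mpoly \<Rightarrow> ('a ^ 'v) set \<Rightarrow> bool" where
  "vanishes_at_point f q \<longleftrightarrow> (\<forall>x\<in>q. poly_eval f (\<lambda>v. x $ v) = 0)"

definition point_ideal :: "('a::field ^ 'v) set \<Rightarrow> ('v, 'a) mpoly set" (\<open>\<mm>\<close>) where
  "\<mm> q = ideal_generated {f. homogeneous f \<and> vanishes_at_point f q}"

definition points_ideal :: "nat \<Rightarrow> (nat \<Rightarrow> ('a::field ^ 'v) set) \<Rightarrow> ('v, 'a) mpoly set" where
  "points_ideal n p = (\<Inter>j<n. \<mm> (p j))"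

definition points_symbolic_power ::
    "nat \<Rightarrow> (nat \<Rightarrow> ('a::field ^ 'v) set) \<Rightarrow> nat \<Rightarrow> ('v, 'a) mpoly set" where
  "points_symbolic_power n p m = (\<Inter>j<n. ideal_power (\<mm> (p j)) m)"

end

theory Submission
  imports Defs "HOL-Computational_Algebra.Polynomial"
begin

text \<open>
  Let \<open>a\<close> be least with \<open>n < (a + 3) choose 3\<close>. Counting conditions gives \<open>\<alpha>(I) \<le> a\<close>, and
  \<open>(a + 2) choose 3 \<le> n\<close>. Emptiness of the system of forms of degree \<open>d = m (a + 2) - k - 1\<close> with
  multiplicity \<open>e = 3 m - k\<close> at \<open>n\<close> points is an open condition, so one special configuration suffices:
  the star configuration of the triple intersections of \<open>a + 2\<close> planes. There a form of degree
  \<open>d\<close> restricts to zero on every plane, by the analogous statement for lines in the plane, and hence is divisible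
  by the product of the planes; the quotient has degree \<open>d - (a + 2)\<close> and multiplicity \<open>e - 3\<close>.

  To make the planes explicit, affine 4-space is identified with the univariate polynomials of degree
  at most 3, and the planes are the kernels of the evaluations at the elements of a finite set \<open>S\<close>. The star points
  are then the polynomials \<open>\<Prod>b\<in>B. (T - b)\<close> with \<open>B \<subseteq> S\<close>, \<open>|B| = 3\<close>.
\<close>

section \<open>Evaluation of polynomials\<close>

lemma poly_mapping_sum_single:
  "f = (\<Sum>k\<in>Poly_Mapping.keys f. Poly_Mapping.single k (Poly_Mapping.lookup f k))"
  by (rule poly_mapping_eqI) (simp add: lookup_sum lookup_single when_def in_keys_iff)

definition mon_eval :: "('v \<Rightarrow>\<^sub>0 nat) \<Rightarrow> ('v \<Rightarrow> 'a::comm_semiring_1) \<Rightarrow> 'a" where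
  "mon_eval mon x = (\<Prod>v\<in>Poly_Mapping.keys mon. x v ^ Poly_Mapping.lookup mon v)"

lemma mon_eval_superset:
  assumes "finite A" "Poly_Mapping.keys mon \<subseteq> A"
  shows "mon_eval mon x = (\<Prod>v\<in>A. x v ^ Poly_Mapping.lookup mon v)"
  unfolding mon_eval_def using assms
  by (intro prod.mono_neutral_left) (auto simp: in_keys_iff)

lemma mon_eval_zero [simp]: "mon_eval 0 x = 1"
  by (simp add: mon_eval_def)

lemma mon_eval_add: "mon_eval (a + b) x = mon_eval a x * mon_eval b x"
proof -
  let ?A = "Poly_Mapping.keys a \<union> Poly_Mapping.keys b"
  have "mon_eval c x = (\<Prod>v\<in>?A. x v ^ Poly_Mapping.lookup c v)" if "c \<in> {a, b, a + b}" for c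
    using that keys_add[of a b] by (intro mon_eval_superset) auto
  then show ?thesis
    by (simp add: lookup_add power_add prod.distrib)
qed

lemma mon_eval_single: "mon_eval (Poly_Mapping.single v k) x = x v ^ k"
  by (simp add: mon_eval_def)

lemma poly_eval_superset:
  assumes "finite A" "Poly_Mapping.keys f \<subseteq> A"
  shows "poly_eval f x = (\<Sum>mon\<in>A. Poly_Mapping.lookup f mon * mon_eval mon x)"
  unfolding poly_eval_def mon_eval_def using assms
  by (intro sum.mono_neutral_left) (auto simp: in_keys_iff)

lemma poly_eval_zero [simp]: "poly_eval 0 x = 0"
  by (simp add: poly_eval_def)

lemma poly_eval_single: "poly_eval (Poly_Mapping.single mon c) x = c * mon_eval mon x"
  by (simp add: poly_eval_def mon_eval_def)

lemma poly_eval_one [simp]: "poly_eval 1 x = 1"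
  using poly_eval_single[of 0 1 x] by simp

lemma poly_eval_add: "poly_eval (f + g) x = poly_eval f x + poly_eval g x"
proof -
  let ?A = "Poly_Mapping.keys f \<union> Poly_Mapping.keys g"
  have "poly_eval h x = (\<Sum>mon\<in>?A. Poly_Mapping.lookup h mon * mon_eval mon x)"
    if "h \<in> {f, g, f + g}" for h
    using that keys_add[of f g] by (intro poly_eval_superset) auto
  then show ?thesis
    by (simp add: lookup_add distrib_right sum.distrib)
qed

lemma poly_eval_sum: "poly_eval (\<Sum>i\<in>A. f i) x = (\<Sum>i\<in>A. poly_eval (f i) x)"
  by (induction A rule: infinite_finite_induct) (simp_all add: poly_eval_add)

lemma poly_eval_mult: "poly_eval (f * g) x = poly_eval f x * poly_eval g x"
proof -
  let ?s = "\<lambda>h k. Poly_Mapping.single k (Poly_Mapping.lookup h k)"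
  have "f * g = (\<Sum>a\<in>Poly_Mapping.keys f. \<Sum>b\<in>Poly_Mapping.keys g. ?s f a * ?s g b)"
    unfolding sum_product[symmetric] poly_mapping_sum_single[symmetric] ..
  then have "poly_eval (f * g) x
      = (\<Sum>a\<in>Poly_Mapping.keys f. \<Sum>b\<in>Poly_Mapping.keys g. poly_eval (?s f a) x * poly_eval (?s g b) x)"
    by (simp add: poly_eval_sum poly_eval_single mult_single mon_eval_add mult.commute mult.left_commute)
  also have "\<dots> = poly_eval (\<Sum>a\<in>Poly_Mapping.keys f. ?s f a) x * poly_eval (\<Sum>b\<in>Poly_Mapping.keys g. ?s g b) x"
    by (simp add: poly_eval_sum sum_product)
  finally show ?thesis
    by (simp only: poly_mapping_sum_single[symmetric])
qed

lemma poly_eval_diff: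
  fixes f g :: "('v, 'a::comm_ring_1) mpoly"
  shows "poly_eval (f - g) x = poly_eval f x - poly_eval g x"
  using poly_eval_add[of "f - g" g x] by simp

lemma poly_eval_line:
  fixes f :: "('v, 'a::comm_ring_1) mpoly"
  shows "\<exists>p. \<forall>t. poly_eval f (\<lambda>v. x v + t * y v) = poly p t"
proof -
  have "mon_eval mon (\<lambda>v. x v + t * y v)
      = poly (\<Prod>v\<in>Poly_Mapping.keys mon. [:x v, y v:] ^ Poly_Mapping.lookup mon v) t" for mon t
    by (simp add: mon_eval_def poly_prod poly_power)
  then have "poly_eval f (\<lambda>v. x v + t * y v) = poly (\<Sum>mon\<in>Poly_Mapping.keys f.
      smult (Poly_Mapping.lookup f mon) (\<Prod>v\<in>Poly_Mapping.keys mon. [:x v, y v:] ^ Poly_Mapping.lookup mon v)) t" for t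
    by (simp add: poly_eval_superset[OF finite_keys order.refl] poly_sum)
  then show ?thesis by blast
qed

section \<open>Linear independence of monomials\<close>

text \<open>With the variables in \<open>V\<close> fixed, the sum is a univariate polynomial in
  \<open>x w\<close> that vanishes everywhere, hence is zero in characteristic zero. Its coefficient
  at exponent \<open>mon w\<close> is the sum over \<open>M' (mon w)\<close>, on which restriction
  to \<open>V\<close> stays injective, so induction applies.\<close>

lemma mon_eval_independent:
  fixes M :: "('v \<Rightarrow> nat) set" and c :: "('v \<Rightarrow> nat) \<Rightarrow> 'a::field_char_0"
  assumes "finite V" "finite M" "inj_on (\<lambda>mon. restrict mon V) M"
    and "\<And>x. (\<Sum>mon\<in>M. c mon * (\<Prod>v\<in>V. x v ^ mon v)) = 0"
    and "mon \<in> M"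
  shows "c mon = 0"
  using assms
proof (induction V arbitrary: M mon rule: finite_induct)
  case empty
  have "M \<subseteq> {mon}"
    using empty.prems(2,4) by (auto simp: inj_on_def)
  then have "M = {mon}" using empty.prems(4) by blast
  then show ?case using empty.prems(3) by simp
next
  case (insert w V)
  define M' where "M' k = {mon\<in>M. mon w = k}" for k
  have fin: "finite (M' k)" for k using insert.prems(1) by (simp add: M'_def)
  show ?case
  proof (rule insert.IH[of "M' (mon w)" mon])
    show "finite (M' (mon w))" by (rule fin)
    show "mon \<in> M' (mon w)" using insert.prems(4) by (simp add: M'_def)
    show "inj_on (\<lambda>mon. restrict mon V) (M' (mon w))"
    proof (rule inj_onI)
      fix a b assume ab: "a \<in> M' (mon w)" "b \<in> M' (mon w)" "restrict a V = restrict b V"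
      have "restrict a (insert w V) v = restrict b (insert w V) v" for v
      proof (cases "v \<in> V")
        case True
        then show ?thesis using fun_cong[OF ab(3), of v] by simp
      next
        case False
        then show ?thesis using ab(1,2) by (simp add: M'_def restrict_def)
      qed
      then have "restrict a (insert w V) = restrict b (insert w V)" by (rule ext)
      then show "a = b"
        using inj_onD[OF insert.prems(2), of a b] ab(1,2) unfolding M'_def by blast
    qed
    fix x :: "'v \<Rightarrow> 'a"
    let ?g = "\<lambda>mon. c mon * (\<Prod>v\<in>V. x v ^ mon v)"
    define p where "p = (\<Sum>mon\<in>M. monom (?g mon) (mon w))"
    have "poly p t = 0" for t
    proof -
      have "(\<Prod>v\<in>V. (x(w := t)) v ^ m v) = (\<Prod>v\<in>V. x v ^ m v)" for m :: "'v \<Rightarrow> nat"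
        using insert.hyps by (intro prod.cong) auto
      then have "poly p t = (\<Sum>mon\<in>M. c mon * (\<Prod>v\<in>insert w V. (x(w := t)) v ^ mon v))"
        using insert.hyps by (simp add: p_def poly_sum poly_monom algebra_simps)
      then show ?thesis using insert.prems(3) by simp
    qed
    then have "p = 0" by (simp add: poly_all_0_iff_0[symmetric])
    then have "0 = coeff p (mon w)" by simp
    also have "\<dots> = (\<Sum>m\<in>M. if m w = mon w then ?g m else 0)"
      by (simp add: p_def coeff_sum)
    also have "\<dots> = (\<Sum>m\<in>M' (mon w). ?g m)"
      using insert.prems(1) by (simp add: M'_def sum.inter_filter)
    finally show "(\<Sum>m\<in>M' (mon w). ?g m) = 0" by simp
  qed
qed

lemma poly_eval_eq_zeroD:
  fixes f :: "('v::finite, 'a::field_char_0) mpoly"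
  assumes "\<And>x. poly_eval f x = 0"
  shows "f = 0"
proof -
  let ?M = "Poly_Mapping.lookup ` Poly_Mapping.keys f"
  have inj: "inj_on Poly_Mapping.lookup A" for A :: "('v \<Rightarrow>\<^sub>0 nat) set"
    by (auto intro!: inj_onI poly_mapping_eqI)
  \<comment> \<open>\<open>mon_eval_independent\<close> indexes by plain functions, so the
    coefficients are transported through \<open>Abs_poly_mapping\<close>.\<close>
  define c where "c = (\<lambda>m. Poly_Mapping.lookup f (Abs_poly_mapping m))"
  have "c m = 0" if "m \<in> ?M" for m
  proof (rule mon_eval_independent[of UNIV ?M c m])
    have "(\<Sum>mon\<in>?M. c mon * (\<Prod>v\<in>UNIV. x v ^ mon v)) = poly_eval f x" for x
      by (subst sum.reindex[OF inj])
        (simp add: c_def lookup_inverse poly_eval_superset[OF finite_keys order.refl] mon_eval_superset[of UNIV])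
    then show "(\<Sum>mon\<in>?M. c mon * (\<Prod>v\<in>UNIV. x v ^ mon v)) = 0" for x
      using assms by simp
  qed (use that in \<open>auto simp: inj_on_def restrict_UNIV\<close>)
  then have "Poly_Mapping.lookup f mon = 0" if "mon \<in> Poly_Mapping.keys f" for mon
    using that by (force simp: c_def lookup_inverse)
  then show ?thesis
    by (intro poly_mapping_eqI) (metis in_keys_iff lookup_zero)
qed

section \<open>Star configurations\<close>

definition lin_fun :: "('a::field_char_0 poly \<Rightarrow> 'a) \<Rightarrow> bool" where
  "lin_fun \<phi> \<longleftrightarrow> (\<forall>x y. \<phi> (x + y) = \<phi> x + \<phi> y) \<and> (\<forall>c x. \<phi> (smult c x) = c * \<phi> x)"

text \<open>Homogeneous polynomial functions are generated from linear functionals instead of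
  coordinates, so that restriction to a hyperplane is composition with a linear map. The domain is
  all polynomials; degree bounds enter only where a lemma fixes the dimension.\<close>

inductive form_fun :: "nat \<Rightarrow> ('a::field_char_0 poly \<Rightarrow> 'a) \<Rightarrow> bool" where
  const: "form_fun 0 (\<lambda>_. c)"
| add: "form_fun d f \<Longrightarrow> form_fun d g \<Longrightarrow> form_fun d (\<lambda>x. f x + g x)"
| mult: "lin_fun \<phi> \<Longrightarrow> form_fun d f \<Longrightarrow> form_fun (Suc d) (\<lambda>x. \<phi> x * f x)"

lemma lin_funD:
  assumes "lin_fun \<phi>"
  shows "\<phi> (x + y) = \<phi> x + \<phi> y" "\<phi> (smult c x) = c * \<phi> x" "\<phi> (x - y) = \<phi> x - \<phi> y" "\<phi> 0 = 0"
proof -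
  show A: "\<phi> (x + y) = \<phi> x + \<phi> y" and S: "\<phi> (smult c x) = c * \<phi> x" for x y c
    using assms by (auto simp: lin_fun_def)
  show "\<phi> (x - y) = \<phi> x - \<phi> y"
    using A[of "x - y" y] by simp
  show "\<phi> 0 = 0"
    using S[of 0 0] by simp
qed

lemma form_fun_zero: "form_fun d (\<lambda>_. 0)"
proof (induction d)
  case 0
  show ?case by (rule const)
next
  case (Suc d)
  have "lin_fun (\<lambda>_::'a poly. 0)" by (simp add: lin_fun_def)
  from mult[OF this Suc] show ?case by simp
qed

lemma form_fun_sum:
  assumes "\<And>i. i \<in> A \<Longrightarrow> form_fun d (f i)"
  shows "form_fun d (\<lambda>x. \<Sum>i\<in>A. f i x)"
  using assms by (induction A rule: infinite_finite_induct) (auto intro: form_fun_zero add)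

lemma form_fun_cmult:
  assumes "form_fun d f"
  shows "form_fun d (\<lambda>x. c * f x)"
  using assms
proof induction
  case (const c')
  show ?case by (rule form_fun.const)
next
  case (add d f g)
  then show ?case using form_fun.add[OF add.IH] by (simp add: algebra_simps)
next
  case (mult \<phi> d f)
  then show ?case using form_fun.mult[OF mult.hyps(1) mult.IH] by (simp add: algebra_simps)
qed

lemma form_fun_mult_power:
  assumes "lin_fun \<phi>" "form_fun d f"
  shows "form_fun (k + d) (\<lambda>x. \<phi> x ^ k * f x)"
proof (induction k)
  case 0
  then show ?case using assms by simp
next
  case (Suc k)
  from mult[OF assms(1) this] show ?case by (simp add: mult.assoc)
qed

text \<open>Applied with \<open>L\<close> multiplication by \<open>T - c\<close>, which identifies
  the polynomials of degree at most \<open>N - 1\<close> with the hyperplane of those of degree at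
  most \<open>N\<close> vanishing at \<open>c\<close>.\<close>

lemma form_fun_compose:
  assumes "form_fun d f"
    and "\<And>x y. L (x + y) = L x + L y" and "\<And>c x. L (smult c x) = smult c (L x)"
  shows "form_fun d (\<lambda>x. f (L x))"
  using assms(1)
proof induction
  case (mult \<phi> d f)
  have "lin_fun (\<lambda>x. \<phi> (L x))"
    using mult.hyps(1) assms(2,3) by (simp add: lin_fun_def)
  then show ?case using mult.IH by (rule form_fun.mult)
qed (auto intro: form_fun.intros)

text \<open>The map \<open>x \<mapsto> x - \<phi> x w\<close> is a projection onto the kernel of \<open>\<phi>\<close> when \<open>\<phi> w = 1\<close>, so this is division by
  \<open>\<phi>\<close> of a form vanishing on that kernel.\<close>

lemma form_fun_division:
  assumes "form_fun d f" "lin_fun \<phi>"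
  shows "case d of 0 \<Rightarrow> \<forall>x. f x = f (x - smult (\<phi> x) w)
    | Suc d' \<Rightarrow> \<exists>g. form_fun d' g \<and> (\<forall>x. f x - f (x - smult (\<phi> x) w) = \<phi> x * g x)"
  using assms(1)
proof induction
  case (const c)
  show ?case by simp
next
  case (add d f g)
  show ?case
  proof (cases d)
    case 0
    with add.IH have "\<forall>x. f x = f (x - smult (\<phi> x) w)" "\<forall>x. g x = g (x - smult (\<phi> x) w)"
      unfolding 0 nat.case by blast+
    then have "f x + g x = f (x - smult (\<phi> x) w) + g (x - smult (\<phi> x) w)" for x by metis
    then show ?thesis unfolding 0 nat.case by blast
  next
    case (Suc d')
    with add.IH obtain f' g' where fg: "form_fun d' f'" "form_fun d' g'"
      "\<And>x. f x - f (x - smult (\<phi> x) w) = \<phi> x * f' x"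
      "\<And>x. g x - g (x - smult (\<phi> x) w) = \<phi> x * g' x" unfolding Suc nat.case by blast
    have "f x + g x - (f (x - smult (\<phi> x) w) + g (x - smult (\<phi> x) w)) = \<phi> x * (f' x + g' x)" for x
      unfolding distrib_left fg(3,4)[symmetric] by simp
    then show ?thesis using form_fun.add[OF fg(1,2)] unfolding Suc nat.case by blast
  qed
next
  case (mult \<psi> d f)
  let ?s = "\<lambda>x. x - smult (\<phi> x) w"
  note \<psi> = lin_funD[OF mult.hyps(1)]
  note \<phi> = lin_funD[OF assms(2)]
  have 1: "form_fun d (\<lambda>x. \<psi> w * f x)" by (rule form_fun_cmult) fact
  show ?case
  proof (cases d)
    case 0
    have "\<psi> x * f x - \<psi> (?s x) * f (?s x) = \<phi> x * (\<psi> w * f x)" for x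
    proof -
      have "f (?s x) = f x" using mult.IH unfolding 0 nat.case by metis
      then show ?thesis by (simp add: \<psi> algebra_simps)
    qed
    then show ?thesis using 1 unfolding nat.case by blast
  next
    case (Suc d')
    with mult.IH obtain g where g: "form_fun d' g" "\<And>x. f x - f (?s x) = \<phi> x * g x"
      unfolding Suc nat.case by blast
    have "lin_fun (\<lambda>x. \<psi> (?s x))"
      by (simp add: lin_fun_def \<psi> \<phi> algebra_simps)
    from form_fun.mult[OF this g(1)]
    have 2: "form_fun d (\<lambda>x. \<psi> (?s x) * g x)" using Suc by simp
    \<comment> \<open>Product rule for differences: one factor changes at a time, and
      \<open>\<psi> x - \<psi> (?s x)\<close> is \<open>\<phi> x\<close> times the constant
      \<open>\<psi> w\<close>.\<close>
    have "\<psi> x * f x - \<psi> (?s x) * f (?s x) = \<phi> x * (\<psi> w * f x + \<psi> (?s x) * g x)" for x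
    proof -
      have "\<psi> x * f x - \<psi> (?s x) * f (?s x) = (\<psi> x - \<psi> (?s x)) * f x + \<psi> (?s x) * (f x - f (?s x))"
        by (simp add: algebra_simps)
      also have "\<psi> x - \<psi> (?s x) = \<phi> x * \<psi> w" by (simp add: \<psi>)
      also have "f x - f (?s x) = \<phi> x * g x" by (rule g)
      finally show ?thesis by (simp add: algebra_simps)
    qed
    with form_fun.add[OF 1 2] show ?thesis unfolding nat.case by blast
  qed
qed

section \<open>Restriction to lines and order of vanishing\<close>

text \<open>Here \<open>t\<close> runs along a line and \<open>u\<close> tilts its direction. A
  linear functional becomes \<open>\<phi> x + t (\<phi> y + u \<phi> z)\<close>, the nested linear
  polynomial of the \<open>mult\<close> case. \<open>H\<close> is a polynomial in \<open>t\<close>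
  whose coefficients are polynomials in \<open>u\<close>.\<close>

lemma form_fun_bivariate:
  assumes "form_fun d f"
  shows "\<exists>H. \<forall>t u. f (x + smult t (y + smult u z)) = poly (poly H [:t:]) u"
  using assms
proof induction
  case (const c)
  show ?case by (rule exI[of _ "[:[:c:]:]"]) simp
next
  case (add d f g)
  then obtain H K where "\<forall>t u. f (x + smult t (y + smult u z)) = poly (poly H [:t:]) u"
    "\<forall>t u. g (x + smult t (y + smult u z)) = poly (poly K [:t:]) u" by blast
  then show ?case by (intro exI[of _ "H + K"]) simp
next
  case (mult \<phi> d f)
  then obtain H where "\<forall>t u. f (x + smult t (y + smult u z)) = poly (poly H [:t:]) u" by blast
  then show ?case
    by (intro exI[of _ "[:[:\<phi> x:], [:\<phi> y, \<phi> z:]:] * H"])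
      (simp add: lin_funD[OF mult.hyps(1)] algebra_simps)
qed

lemma form_fun_line:
  assumes "form_fun d f"
  shows "\<exists>h. \<forall>t. f (x + smult t y) = poly h t"
proof -
  \<comment> \<open>The direction \<open>0\<close> tilted by \<open>u y\<close>, taken at
    \<open>t = 1\<close>, traces the line itself.\<close>
  obtain H where H: "\<And>t u. f (x + smult t (0 + smult u y)) = poly (poly H [:t:]) u"
    using form_fun_bivariate[OF assms] by blast
  have "f (x + smult t y) = poly (poly H [:1:]) t" for t
    using H[of 1 t] by simp
  then show ?thesis by blast
qed

lemma poly_map_poly_poly: "poly (map_poly (\<lambda>p. poly p u) H) t = poly (poly H [:t:]) u"
  by (induction H) (simp_all add: map_poly_pCons)

text \<open>Multiplicity at least \<open>e\<close> at \<open>x\<close> is expressed, without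
  derivatives, by asking this for every direction \<open>y\<close>.\<close>

definition vanish_order :: "nat \<Rightarrow> ('a::field_char_0 poly \<Rightarrow> 'a) \<Rightarrow> 'a poly \<Rightarrow> 'a poly \<Rightarrow> bool" where
  "vanish_order e f x y \<longleftrightarrow> (\<exists>q. \<forall>t. f (x + smult t y) = t ^ e * poly q t)"

text \<open>Dividing by \<open>\<Prod>c\<in>S. poly x c\<close> controls the order along \<open>y\<close> only if \<open>y\<close> has no zero in \<open>B\<close>; the other
  directions are limits of such ones.\<close>

lemma vanish_order_density:
  assumes f: "form_fun d f" and fin: "finite X"
    and ord: "\<And>u. u \<notin> X \<Longrightarrow> vanish_order e f x (y + smult u z)"
  shows "vanish_order e f x y"
proof -
  obtain H where H: "\<And>t u. f (x + smult t (y + smult u z)) = poly (poly H [:t:]) u"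
    using form_fun_bivariate[OF f] by blast
  \<comment> \<open>For \<open>i < e\<close> the coefficient of \<open>t ^ i\<close> in
    \<open>H\<close> is a polynomial in \<open>u\<close> that vanishes off the finite set
    \<open>X\<close>, hence is zero. Then \<open>t ^ e\<close> divides \<open>H\<close>, and
    \<open>u = 0\<close> may be substituted.\<close>
  have co: "poly (coeff H i) u = 0" if u: "u \<notin> X" and i: "i < e" for u i
  proof -
    let ?h = "map_poly (\<lambda>p. poly p u) H"
    obtain q where q: "\<And>t. f (x + smult t (y + smult u z)) = t ^ e * poly q t"
      using ord[OF u] by (auto simp: vanish_order_def)
    have "poly ?h = poly (monom 1 e * q)"
      using q by (auto simp: poly_map_poly_poly H[symmetric] poly_monom)
    then have "?h = monom 1 e * q" by (simp only: poly_eq_poly_eq_iff)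
    then have "monom 1 e dvd ?h" by simp
    then show ?thesis using i by (simp add: monom_1_dvd_iff' coeff_map_poly)
  qed
  have "coeff H i = 0" if "i < e" for i
  proof (rule ccontr)
    assume "coeff H i \<noteq> 0"
    then have "finite {u. poly (coeff H i) u = 0}" by (rule poly_roots_finite)
    moreover have "- X \<subseteq> {u. poly (coeff H i) u = 0}" using co that by auto
    ultimately have "finite (- X)" by (rule finite_subset[rotated])
    then show False using fin infinite_UNIV_char_0[where 'a='a] by (metis finite_Un Compl_partition)
  qed
  then have "monom 1 e dvd H" by (simp add: monom_1_dvd_iff')
  then obtain K where K: "H = monom 1 e * K" by blast
  have "f (x + smult t y) = t ^ e * poly (map_poly (\<lambda>p. poly p 0) K) t" for t
    using H[of t 0] by (simp add: K poly_monom poly_map_poly_poly poly_power)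
  then show ?thesis by (auto simp: vanish_order_def)
qed

text \<open>The planes are divided out one at a time. The quotient still vanishes on each remaining
  plane: off the plane of \<open>c\<close> because the factor \<open>poly x c\<close> is nonzero,
  and on it by continuity along a line. A form whose degree runs out first is zero, whence the first
  alternative.\<close>

lemma form_fun_divide_planes:
  assumes "finite S" "form_fun d f" "N \<ge> 1"
    and "\<And>c x. c \<in> S \<Longrightarrow> degree x \<le> N \<Longrightarrow> poly x c = 0 \<Longrightarrow> f x = 0"
  shows "(\<forall>x. degree x \<le> N \<longrightarrow> f x = 0) \<or>
    (card S \<le> d \<and> (\<exists>g. form_fun (d - card S) g \<and>
       (\<forall>x. degree x \<le> N \<longrightarrow> f x = (\<Prod>c\<in>S. poly x c) * g x)))"
  using assms(1,2,4)
proof (induction S arbitrary: d f rule: finite_induct)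
  case empty
  then show ?case by auto
next
  case (insert c S)
  let ?s = "\<lambda>x. x - smult (poly x c) 1"
  have "lin_fun (\<lambda>x. poly x c)" by (simp add: lin_fun_def)
  note div = form_fun_division[OF insert.prems(1) this, of 1]
  have f0: "f (?s x) = 0" if "degree x \<le> N" for x
  proof (rule insert.prems(2)[of c])
    show "degree (?s x) \<le> N" using that by (auto intro!: degree_diff_le)
  qed auto
  show ?case
  proof (cases d)
    case 0
    with div have "f x = f (?s x)" for x unfolding 0 nat.case by blast
    then show ?thesis using f0 by metis
  next
    case (Suc d')
    with div obtain g where g: "form_fun d' g" "\<And>x. f x - f (?s x) = poly x c * g x"
      unfolding Suc nat.case by blast
    have fg: "f x = poly x c * g x" if "degree x \<le> N" for x
      using g(2)[of x] f0[OF that] by simp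
    have g0: "g x = 0" if b: "b \<in> S" and deg: "degree x \<le> N" and xb: "poly x b = 0" for b x
    proof (cases "poly x c = 0")
      case False
      have "f x = 0" using insert.prems(2)[of b x] that by simp
      then show ?thesis using fg[OF deg] False by simp
    next
      case True
      \<comment> \<open>The direction \<open>T - b\<close> keeps the line in the plane of
        \<open>b\<close> and moves it off that of \<open>c\<close>, since \<open>b\<close> and
        \<open>c\<close> differ.\<close>
      let ?w = "[:- b, 1:]"
      have cb: "poly ?w c \<noteq> 0" using insert.hyps b by auto
      obtain h where h: "\<And>t. g (x + smult t ?w) = poly h t" using form_fun_line[OF g(1)] by blast
      \<comment> \<open>The factor \<open>monom 1 1\<close> takes care of \<open>t = 0\<close>,
        where the line meets the plane of \<open>c\<close>.\<close>
      have "poly (monom 1 1 * h) t = 0" for t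
      proof (cases "t = 0")
        case False
        let ?y = "x + smult t ?w"
        have d: "degree ?y \<le> N" using deg assms(3)
          by (intro degree_add_le order.trans[OF degree_smult_le]) auto
        have "poly ?y b = 0" using xb by simp
        then have "f ?y = 0" using insert.prems(2)[of b ?y] b d by simp
        moreover have "poly ?y c \<noteq> 0" using True cb False by simp
        ultimately have "g ?y = 0" using fg[OF d] by simp
        then show ?thesis using h[of t] by simp
      qed (simp add: poly_monom)
      then have "monom 1 1 * h = 0" by (simp add: poly_all_0_iff_0[symmetric])
      then have "h = 0" by simp
      then show ?thesis using h[of 0] by simp
    qed
    have "(\<forall>x. degree x \<le> N \<longrightarrow> g x = 0) \<or>
        (card S \<le> d' \<and> (\<exists>k. form_fun (d' - card S) k \<and>
           (\<forall>x. degree x \<le> N \<longrightarrow> g x = (\<Prod>c\<in>S. poly x c) * k x)))"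
      by (rule insert.IH) (use g(1) g0 in auto)
    then show ?thesis
    proof (elim disjE conjE exE)
      assume "\<forall>x. degree x \<le> N \<longrightarrow> g x = 0"
      then show ?thesis using fg by auto
    next
      fix k assume "card S \<le> d'" "form_fun (d' - card S) k"
        "\<forall>x. degree x \<le> N \<longrightarrow> g x = (\<Prod>c\<in>S. poly x c) * k x"
      then show ?thesis using fg insert.hyps Suc
        by (intro disjI2 conjI exI[of _ k]) (auto simp: algebra_simps)
    qed
  qed
qed

lemma form_fun_smult:
  assumes "form_fun d f"
  shows "f (smult c x) = c ^ d * f x"
  using assms
proof induction
  case (mult \<phi> d f)
  have "\<phi> (smult c x) = c * \<phi> x" by (rule lin_funD(2)) fact
  then show ?case using mult.IH by simp
next
  case (add d f g)
  then show ?case by (simp only: distrib_left)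
qed simp

text \<open>Exactly the planes of the \<open>N\<close> elements of \<open>B\<close> pass through the
  point, so along a direction lying in none of them the product has order exactly \<open>N\<close>,
  which leaves \<open>e - N\<close> for \<open>g\<close>. \<open>vanish_order_density\<close>
  reaches the other directions.\<close>

lemma vanish_order_cofactor:
  assumes g: "form_fun d g" and S: "finite S" "B \<subseteq> S" "card B = N" "N \<ge> 1"
    and ord: "\<And>y. degree y \<le> N \<Longrightarrow>
       vanish_order e (\<lambda>x. (\<Prod>c\<in>S. poly x c) * g x) (\<Prod>b\<in>B. [:- b, 1:]) y"
    and y: "degree y \<le> N"
  shows "vanish_order (e - N) g (\<Prod>b\<in>B. [:- b, 1:]) y"
proof -
  let ?P = "\<Prod>b\<in>B. [:- b, 1:]"
  have B: "finite B" using S finite_subset by blast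
  \<comment> \<open>Directions are tilted by the constant polynomial \<open>1\<close>:
    \<open>y + u\<close> has a zero at \<open>b\<close> exactly for
    \<open>u = - poly y b\<close>.\<close>
  define X where "X = (\<Union>b\<in>B. {- poly y b})"
  have "vanish_order (e - N) g ?P (y + smult u 1)" if u: "u \<notin> X" for u
  proof -
    let ?y = "y + smult u 1"
    have y': "degree ?y \<le> N" using y by (intro degree_add_le) auto
    have yb: "poly ?y b \<noteq> 0" if "b \<in> B" for b
      using u that by (auto simp: X_def add_eq_0_iff)
    obtain q where q: "\<And>t. (\<Prod>c\<in>S. poly (?P + smult t ?y) c) * g (?P + smult t ?y) = t ^ e * poly q t"
      using ord[OF y'] by (auto simp: vanish_order_def)
    obtain h where h: "\<And>t. g (?P + smult t ?y) = poly h t" using form_fun_line[OF g] by blast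
    \<comment> \<open>On the line the planes of \<open>B\<close> contribute \<open>t ^ N\<close>
      times the constant \<open>K\<close>; the others contribute \<open>U\<close>, which is nonzero
      at \<open>0\<close>.\<close>
    define K where "K = (\<Prod>b\<in>B. poly ?y b)"
    define U where "U = (\<Prod>c\<in>S-B. [:poly ?P c, poly ?y c:])"
    have K0: "K \<noteq> 0" using yb B by (auto simp: K_def)
    have PC: "poly ?P c \<noteq> 0" if "c \<in> S - B" for c
      using that B by (auto simp: poly_prod)
    have "poly U 0 = (\<Prod>c\<in>S-B. poly [:poly ?P c, poly ?y c:] 0)"
      unfolding U_def by (rule poly_prod)
    then have "poly U 0 \<noteq> 0"
      using S PC by (simp only: prod_zero_iff finite_Diff poly_pCons) auto
    then have U0: "order 0 U = 0" and U0': "U \<noteq> 0" by (auto simp: order_root)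
    have PB: "poly ?P b = 0" if "b \<in> B" for b
      using that B by (auto simp: poly_prod intro!: prod_zero)
    have "poly (smult K (monom 1 N * U * h)) t = poly (monom 1 e * q) t" for t
    proof -
      have "(\<Prod>c\<in>S. poly (?P + smult t ?y) c)
          = (\<Prod>c\<in>S-B. poly (?P + smult t ?y) c) * (\<Prod>c\<in>B. poly (?P + smult t ?y) c)"
        by (rule prod.subset_diff) (use S in auto)
      also have "(\<Prod>c\<in>B. poly (?P + smult t ?y) c) = (\<Prod>c\<in>B. t * poly ?y c)"
        by (rule prod.cong) (auto simp: PB)
      also have "\<dots> = t ^ N * K"
        by (simp add: prod.distrib S K_def)
      also have "(\<Prod>c\<in>S-B. poly (?P + smult t ?y) c)
          = (\<Prod>c\<in>S-B. poly [:poly ?P c, poly ?y c:] t)"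
        by simp
      also have "\<dots> = poly U t"
        unfolding U_def by (rule poly_prod[symmetric])
      finally show ?thesis using q[of t] h[of t] by (simp add: poly_monom algebra_simps)
    qed
    then have "smult K (monom 1 N * U * h) = monom 1 e * q" by (intro poly_ext)
    then have "[:- 0, 1:] ^ e dvd smult K (monom 1 N * U * h)" by (simp add: monom_altdef)
    then have dv: "[:- 0, 1:] ^ e dvd [:- 0, 1:] ^ N * U * h"
      using K0 by (simp add: dvd_smult_iff monom_altdef)
    have "[:- 0, 1:] ^ (e - N) dvd h"
    proof (cases "h = 0")
      case False
      have n0: "[:- 0, 1::'a:] ^ N \<noteq> 0" by simp
      with False U0' have nz: "[:- 0, 1:] ^ N * U * h \<noteq> 0" by simp
      have "order 0 ([:- 0, 1:] ^ N * U * h) = N + order 0 h"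
        using nz U0 order_power_n_n[of 0 N] by (simp add: order_mult)
      moreover have "e \<le> order 0 ([:- 0, 1:] ^ N * U * h)"
        using dv nz order_divides by metis
      ultimately have "e - N \<le> order 0 h" by linarith
      then show ?thesis using order_divides by blast
    qed simp
    then obtain r where "h = monom 1 (e - N) * r" by (auto simp: monom_altdef)
    then have "g (?P + smult t ?y) = t ^ (e - N) * poly r t" for t
      by (simp only: h poly_mult poly_monom) simp
    then show ?thesis
      unfolding vanish_order_def by blast
  qed
  moreover have "finite X" using B by (simp add: X_def)
  ultimately show ?thesis using vanish_order_density[OF g] by blast
qed

text \<open>The hypotheses say \<open>d < \<lceil>e / N\<rceil> (|S| - N) + e\<close>. On the hyperplane of the polynomials
  vanishing at \<open>c\<close> the configuration is, after division by \<open>T - c\<close>, the star configuration of \<open>S - {c}\<close> in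
  dimension \<open>N - 1\<close>. Hence the form vanishes on all hyperplanes; dividing by them lowers \<open>e\<close> by \<open>N\<close>
  and \<open>d\<close> by \<open>|S|\<close>.\<close>

lemma star_vanishing:
  assumes "finite S" "N \<le> card S" "form_fun d f"
    and "\<And>B y. B \<subseteq> S \<Longrightarrow> card B = N \<Longrightarrow> degree y \<le> N \<Longrightarrow>
       vanish_order e f (\<Prod>b\<in>B. [:- b, 1:]) y"
    and "N * m < e + N" "d < m * (card S - N) + e"
    and "degree x \<le> N"
  shows "f x = 0"
  using assms
proof (induction N arbitrary: S d f e m x)
  case 0
  \<comment> \<open>In dimension \<open>0\<close> the only star point is the constant
    \<open>1\<close>, and the hypothesis on \<open>m\<close> reads \<open>0 < e\<close>. So
    \<open>f\<close> vanishes at \<open>1\<close> and, by homogeneity, at all constants.\<close>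
  have "vanish_order e f (\<Prod>b\<in>{}. [:- b, 1:]) 0" by (rule 0) auto
  then obtain q where "\<And>t. f 1 = t ^ e * poly q t" by (auto simp: vanish_order_def)
  from this[of 0] have "f 1 = 0" using 0 by simp
  moreover have "x = smult (coeff x 0) 1" using 0 by (auto elim: degree_eq_zeroE)
  ultimately show ?case using form_fun_smult[OF 0(3), of "coeff x 0" 1] by simp
next
  case (Suc M)
  let ?N = "Suc M"
  let ?P = "\<lambda>B. \<Prod>b\<in>B. [:- b, 1:]"
  note S = Suc.prems(1,2)
  \<comment> \<open>The inner induction on \<open>e\<close> serves the division by all planes; the
    outer one on \<open>N\<close> serves the restriction to a single plane.\<close>
  from Suc.prems(3-7) show ?case
  proof (induction e arbitrary: d f m x rule: less_induct)
    case (less e)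
    note f = less.prems(1) and ord = less.prems(2) and m = less.prems(3) and d = less.prems(4)
    have e: "e > 0"
    proof (rule ccontr)
      assume "\<not> e > 0"
      then have "m = 0" "e = 0" using m by (cases m; simp)+
      then show False using d by simp
    qed
    have "f x = 0" if c: "c \<in> S" and x: "degree x \<le> ?N" "poly x c = 0" for c x
    proof -
      have "[:- c, 1:] dvd x" using x by (simp add: poly_eq_0_iff_dvd)
      then obtain g where g: "x = [:- c, 1:] * g" by blast
      have gM: "degree g \<le> M"
      proof (cases "g = 0")
        case False
        then show ?thesis using x g by (simp add: degree_mult_eq del: mult_pCons_left)
      qed simp
      have "f ([:- c, 1:] * g) = 0"
      \<comment> \<open>\<open>e\<close>, \<open>m\<close> and \<open>d\<close> are kept: the number
        of planes and the dimension both drop by one, so their difference is unchanged.\<close>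
      proof (rule Suc.IH[where f = "\<lambda>g. f ([:- c, 1:] * g)" and S = "S - {c}" and e = e and m = m and d = d])
        show "finite (S - {c})" "M \<le> card (S - {c})" using S c by auto
        show "form_fun d (\<lambda>g. f ([:- c, 1:] * g))"
          using f by (rule form_fun_compose) (simp_all only: distrib_left mult_smult_right)
        show "M * m < e + M" using m e by (cases m) auto
        show "d < m * (card (S - {c}) - M) + e" using d S c by simp
        show "degree g \<le> M" by (rule gM)
      next
        fix B y assume B: "B \<subseteq> S - {c}" "card B = M" and y: "degree (y::'a poly) \<le> M"
        have fB: "finite B" "c \<notin> B" using S B finite_subset by auto
        have "degree ([:- c, 1:] * y) \<le> ?N"
          using degree_mult_le[of "[:- c, 1:]" y] y by simp
        then have "vanish_order e f (?P (insert c B)) ([:- c, 1:] * y)"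
          using B c fB by (intro ord) auto
        moreover have "?P (insert c B) + smult t ([:- c, 1:] * y) = [:- c, 1:] * (?P B + smult t y)" for t
          by (simp only: prod.insert[OF fB] distrib_left mult_smult_right)
        ultimately show "vanish_order e (\<lambda>g. f ([:- c, 1:] * g)) (?P B) y"
          by (simp only: vanish_order_def)
      qed
      then show ?thesis using g by simp
    qed
    then have "(\<forall>x. degree x \<le> ?N \<longrightarrow> f x = 0) \<or>
        (card S \<le> d \<and> (\<exists>g. form_fun (d - card S) g \<and>
           (\<forall>x. degree x \<le> ?N \<longrightarrow> f x = (\<Prod>c\<in>S. poly x c) * g x)))"
      by (intro form_fun_divide_planes[OF S(1) f]) auto
    then show ?case
    proof (elim disjE conjE exE)
      assume "\<forall>x. degree x \<le> ?N \<longrightarrow> f x = 0"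
      then show ?thesis using less.prems by blast
    next
      fix g assume sd: "card S \<le> d" and g: "form_fun (d - card S) g"
        and fg: "\<forall>x. degree x \<le> ?N \<longrightarrow> f x = (\<Prod>c\<in>S. poly x c) * g x"
      have "g x = 0"
      proof (rule less.IH[of "e - ?N" "d - card S" g "m - 1" x])
        show "e - ?N < e" using e by simp
        show "form_fun (d - card S) g" by (rule g)
        show "degree x \<le> ?N" by (rule less.prems)
        show "?N * (m - 1) < e - ?N + ?N" using m by (cases m) auto
        \<comment> \<open>For positive \<open>m\<close> both sides drop by \<open>card S\<close>, as
          the right side loses \<open>card S - ?N\<close> and \<open>?N\<close>. Truncation does no
          harm, since \<open>e < ?N\<close> would force \<open>m \<le> 1\<close> and hence
          \<open>d < card S\<close>.\<close>
        have "e \<ge> ?N \<and> d - card S < (m - 1) * (card S - ?N) + (e - ?N)"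
        proof (cases m)
          case 0
          then show ?thesis using d sd S by auto
        next
          case (Suc m')
          have "\<not> e < ?N"
          proof
            assume "e < ?N"
            then have "m' = 0" using m Suc by (cases m') auto
            then show False using d sd Suc \<open>e < ?N\<close> S by simp
          qed
          then show ?thesis using d sd S Suc by simp
        qed
        then show "d - card S < (m - 1) * (card S - ?N) + (e - ?N)" by (rule conjunct2)
      next
        fix B y assume B: "B \<subseteq> S" "card B = ?N" and y: "degree (y::'a poly) \<le> ?N"
        have dP: "degree (?P B) \<le> ?N"
          using degree_prod_sum_le[of B "\<lambda>b. [:- b, 1:]"] B S finite_subset by (auto simp: o_def)
        show "vanish_order (e - ?N) g (?P B) y"
        proof (rule vanish_order_cofactor[OF g S(1) B _ _ y])
          fix y assume y: "degree (y::'a poly) \<le> ?N"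
          have "degree (?P B + smult t y) \<le> ?N" for t
            using dP y by (intro degree_add_le order.trans[OF degree_smult_le])
          then show "vanish_order e (\<lambda>x. (\<Prod>c\<in>S. poly x c) * g x) (?P B) y"
            using ord[OF B y] fg by (simp add: vanish_order_def)
        qed simp
      qed
      then show ?thesis using fg less.prems by simp
    qed
  qed
qed

section \<open>Forms of a given degree\<close>

lemma homogeneous_of_degree_iff:
  fixes F :: "('v::finite, 'a::zero) mpoly"
  shows "homogeneous_of_degree d F \<longleftrightarrow>
    (\<forall>mon\<in>Poly_Mapping.keys F. (\<Sum>v\<in>UNIV. Poly_Mapping.lookup mon v) = d)"
proof -
  have "(\<Sum>v\<in>Poly_Mapping.keys mon. Poly_Mapping.lookup mon v) = (\<Sum>v\<in>UNIV. Poly_Mapping.lookup mon v)"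
    for mon :: "'v \<Rightarrow>\<^sub>0 nat"
    by (rule sum.mono_neutral_left) (auto simp: in_keys_iff)
  then show ?thesis by (simp add: homogeneous_of_degree_def)
qed

lemma homogeneous_of_degree_mult:
  fixes F G :: "('v::finite, 'a::semiring_0) mpoly"
  assumes "homogeneous_of_degree d F" "homogeneous_of_degree d' G"
  shows "homogeneous_of_degree (d + d') (F * G)"
  using assms keys_mult[of F G]
  by (fastforce simp: homogeneous_of_degree_iff lookup_add sum.distrib)

lemma homogeneous_of_degree_power:
  fixes F :: "('v::finite, 'a::semiring_1) mpoly"
  assumes "homogeneous_of_degree d F"
  shows "homogeneous_of_degree (e * d) (F ^ e)"
proof (induction e)
  case 0
  show ?case by (auto simp: homogeneous_of_degree_iff simp flip: single_one)
next
  case (Suc e)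
  from homogeneous_of_degree_mult[OF assms this] show ?case by simp
qed

lemma homogeneous_of_degree_single:
  fixes mon :: "'v::finite \<Rightarrow>\<^sub>0 nat"
  assumes "(\<Sum>v\<in>UNIV. Poly_Mapping.lookup mon v) = d"
  shows "homogeneous_of_degree d (Poly_Mapping.single mon c)"
  using assms by (simp add: homogeneous_of_degree_iff)

lemma homogeneous_of_degree_add:
  assumes "homogeneous_of_degree d F" "homogeneous_of_degree d G"
  shows "homogeneous_of_degree d (F + G)"
  using assms keys_add[of F G] by (auto simp: homogeneous_of_degree_def)

lemma homogeneous_of_degree_sum:
  assumes "\<And>i. i \<in> A \<Longrightarrow> homogeneous_of_degree d (F i)"
  shows "homogeneous_of_degree d (\<Sum>i\<in>A. F i)"
  using assms
  by (induction A rule: infinite_finite_induct)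
    (auto intro: homogeneous_of_degree_add simp: homogeneous_of_degree_def[of _ 0])

lemma poly_eval_homogeneous_scale:
  fixes F :: "('v::finite, 'a::comm_semiring_1) mpoly"
  assumes "homogeneous_of_degree d F"
  shows "poly_eval F (\<lambda>v. c * x v) = c ^ d * poly_eval F x"
proof -
  have "mon_eval mon (\<lambda>v. c * x v) = c ^ d * mon_eval mon x" if "mon \<in> Poly_Mapping.keys F" for mon
    using that assms
    by (auto simp: mon_eval_superset[of UNIV] power_mult_distrib prod.distrib
        homogeneous_of_degree_iff simp flip: power_sum)
  then show ?thesis
    by (simp add: poly_eval_superset[OF finite_keys order.refl] sum_distrib_left mult.left_commute)
qed

section \<open>Counting monomials\<close>

definition monomials_of_degree :: "nat \<Rightarrow> ('v::finite \<Rightarrow>\<^sub>0 nat) set" where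
  "monomials_of_degree d = {mon. (\<Sum>v\<in>UNIV. Poly_Mapping.lookup mon v) = d}"

text \<open>Stars and bars: an enumeration \<open>h\<close> of the variables turns exponent vectors
  into lists of fixed length and fixed sum.\<close>

lemma card_monomials_of_degree:
  "finite (monomials_of_degree d :: ('v::finite \<Rightarrow>\<^sub>0 nat) set)"
  "card (monomials_of_degree d :: ('v::finite \<Rightarrow>\<^sub>0 nat) set) = (d + CARD('v) - 1) choose d"
proof -
  let ?L = "{l::nat list. length l = CARD('v) \<and> sum_list l = d}"
  let ?M = "monomials_of_degree d :: ('v \<Rightarrow>\<^sub>0 nat) set"
  obtain h :: "nat \<Rightarrow> 'v" where h: "bij_betw h {0..<CARD('v)} UNIV"
    using ex_bij_betw_nat_finite[of "UNIV :: 'v set"] by auto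
  define g where "g = the_inv_into {0..<CARD('v)} h"
  have gh: "g (h i) = i" if "i < CARD('v)" for i
    unfolding g_def using h that by (intro the_inv_into_f_f) (auto simp: bij_betw_def)
  have hg: "h (g v) = v" for v
    unfolding g_def using h by (intro f_the_inv_into_f_bij_betw) auto
  have gN: "g v < CARD('v)" for v
    using the_inv_into_into[of h "{0..<CARD('v)}" v "{0..<CARD('v)}"] h
    by (simp add: g_def bij_betw_def)
  have sum: "(\<Sum>v\<in>UNIV. k v) = sum_list (map (\<lambda>i. k (h i)) [0..<CARD('v)])" for k :: "'v \<Rightarrow> nat"
    by (subst sum.reindex_bij_betw[OF h, symmetric]) (simp add: sum_list_distinct_conv_sum_set)
  have bij: "bij_betw (\<lambda>mon. map (\<lambda>i. Poly_Mapping.lookup mon (h i)) [0..<CARD('v)]) ?M ?L"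
  proof (rule bij_betw_byWitness[where f' = "\<lambda>l. Abs_poly_mapping (\<lambda>v. l ! g v)"])
    show "\<forall>mon\<in>?M. Abs_poly_mapping (\<lambda>v. map (\<lambda>i. Poly_Mapping.lookup mon (h i)) [0..<CARD('v)] ! g v) = mon"
      by (auto simp: gN hg intro!: poly_mapping_eqI)
    show "\<forall>l\<in>?L. map (\<lambda>i. Poly_Mapping.lookup (Abs_poly_mapping (\<lambda>v. l ! g v)) (h i)) [0..<CARD('v)] = l"
      by (auto simp: gh intro!: nth_equalityI)
    show "(\<lambda>mon. map (\<lambda>i. Poly_Mapping.lookup mon (h i)) [0..<CARD('v)]) ` ?M \<subseteq> ?L"
      by (auto simp: monomials_of_degree_def sum)
    have "map (\<lambda>i. l ! g (h i)) [0..<CARD('v)] = l" if "length l = CARD('v)" for l :: "nat list"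
      using that gh by (auto intro!: nth_equalityI)
    then show "(\<lambda>l. Abs_poly_mapping (\<lambda>v. l ! g v)) ` ?L \<subseteq> ?M"
      by (auto simp: monomials_of_degree_def sum)
  qed
  have "finite ?L"
    by (rule finite_subset[OF _ finite_lists_length_eq[of "{..d}" "CARD('v)"]])
      (auto intro: member_le_sum_list)
  then show "finite ?M" using bij_betw_finite[OF bij] by blast
  show "card ?M = (d + CARD('v) - 1) choose d"
    using bij_betw_same_card[OF bij] card_length_sum_list[of "CARD('v)" d] by simp
qed

lemma homogeneous_of_degree_sum_monomials:
  fixes F :: "('v::finite, 'a::comm_semiring_1) mpoly"
  assumes "homogeneous_of_degree d F"
  shows "poly_eval F x = (\<Sum>mon\<in>monomials_of_degree d. Poly_Mapping.lookup F mon * mon_eval mon x)"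
  using assms
  by (intro poly_eval_superset card_monomials_of_degree)
    (auto simp: homogeneous_of_degree_iff monomials_of_degree_def)

definition form_of_coeffs :: "nat \<Rightarrow> (('v::finite \<Rightarrow>\<^sub>0 nat) \<Rightarrow> 'a::comm_semiring_1) \<Rightarrow> ('v, 'a) mpoly" where
  "form_of_coeffs d w = (\<Sum>mon\<in>monomials_of_degree d. Poly_Mapping.single mon (w mon))"

lemma form_of_coeffs:
  shows homogeneous_form_of_coeffs: "homogeneous_of_degree d (form_of_coeffs d w)"
    and poly_eval_form_of_coeffs:
      "poly_eval (form_of_coeffs d w) x = (\<Sum>mon\<in>monomials_of_degree d. w mon * mon_eval mon x)"
    and lookup_form_of_coeffs:
      "mon \<in> monomials_of_degree d \<Longrightarrow> Poly_Mapping.lookup (form_of_coeffs d w) mon = w mon"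
  by (auto simp: form_of_coeffs_def lookup_sum lookup_single when_def poly_eval_sum poly_eval_single
      monomials_of_degree_def[of d] card_monomials_of_degree[unfolded monomials_of_degree_def]
      intro!: homogeneous_of_degree_sum homogeneous_of_degree_single)

section \<open>Linear systems with multihomogeneous coefficients\<close>

text \<open>Gaussian elimination, one equation at a time: a pivot removes an equation and an
  unknown, a zero row only an equation, so the unknowns stay in the majority.\<close>

lemma underdetermined_solution:
  fixes r :: "'i \<Rightarrow> 'c \<Rightarrow> 'a::field"
  assumes "finite R" "finite C" "card R < card C"
  shows "\<exists>w. (\<exists>c\<in>C. w c \<noteq> 0) \<and> (\<forall>i\<in>R. (\<Sum>c\<in>C. r i c * w c) = 0)"
  using assms
proof (induction R arbitrary: C r rule: finite_induct)
  case empty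
  then have "C \<noteq> {}" by auto
  then show ?case by (intro exI[of _ "\<lambda>_. 1"]) auto
next
  case (insert i0 R)
  show ?case
  proof (cases "\<forall>c\<in>C. r i0 c = 0")
    case True
    have "card R < card C" using insert by simp
    from insert.IH[OF insert.prems(1) this] True show ?thesis by simp
  next
    case False
    then obtain c0 where c0: "c0 \<in> C" "r i0 c0 \<noteq> 0" by blast
    let ?C = "C - {c0}"
    have "card R < card ?C" "finite ?C" using insert c0 by auto
    from insert.IH[OF this(2,1), of "\<lambda>i c. r i0 c0 * r i c - r i c0 * r i0 c"]
    obtain w c1 where w: "c1 \<in> ?C" "w c1 \<noteq> 0"
      "\<And>i. i \<in> R \<Longrightarrow> (\<Sum>c\<in>?C. (r i0 c0 * r i c - r i c0 * r i0 c) * w c) = 0"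
      by blast
    define w' where "w' = w(c0 := - (\<Sum>c\<in>?C. r i0 c * w c) / r i0 c0)"
    have sum: "(\<Sum>c\<in>C. r i c * w' c)
        = r i c0 * (- (\<Sum>c\<in>?C. r i0 c * w c) / r i0 c0) + (\<Sum>c\<in>?C. r i c * w c)" for i
      using insert.prems c0 by (simp add: w'_def sum.remove[of C c0])
    have "(\<Sum>c\<in>C. r i c * w' c) = 0" if i: "i \<in> insert i0 R" for i
    proof -
      have "r i0 c0 * (\<Sum>c\<in>?C. r i c * w c) = r i c0 * (\<Sum>c\<in>?C. r i0 c * w c)"
        using w(3)[of i] i by (auto simp: sum_distrib_left left_diff_distrib sum_subtractf mult.assoc)
      then show ?thesis unfolding sum using c0 by (simp add: field_simps)
    qed
    moreover have "w' c1 \<noteq> 0" "c1 \<in> C" using w by (auto simp: w'_def)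
    ultimately show ?thesis by blast
  qed
qed

section \<open>Multidegrees and elimination\<close>

text \<open>Exposes the degrees that \<open>multihomogeneous\<close> quantifies away, so that sums
  and differences can be formed within a common multidegree.\<close>

definition multidegree :: "nat \<Rightarrow> (nat \<Rightarrow> nat) \<Rightarrow> (nat \<times> 'v::finite, 'a::zero) mpoly \<Rightarrow> bool" where
  "multidegree n \<delta> F \<longleftrightarrow> (\<forall>mon\<in>Poly_Mapping.keys F. Poly_Mapping.keys mon \<subseteq> {..<n} \<times> UNIV \<and>
     (\<forall>i<n. (\<Sum>v\<in>UNIV. Poly_Mapping.lookup mon (i, v)) = \<delta> i))"

lemma multidegree_imp_multihomogeneous: "multidegree n \<delta> F \<Longrightarrow> multihomogeneous n F"
  unfolding multidegree_def multihomogeneous_def by blast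

lemma multidegree_mult:
  fixes F G :: "(nat \<times> 'v::finite, 'a::semiring_0) mpoly"
  assumes "multidegree n \<delta> F" "multidegree n \<epsilon> G"
  shows "multidegree n (\<lambda>i. \<delta> i + \<epsilon> i) (F * G)"
  unfolding multidegree_def
proof
  fix mon assume "mon \<in> Poly_Mapping.keys (F * G)"
  then obtain a b where ab: "mon = a + b" "a \<in> Poly_Mapping.keys F" "b \<in> Poly_Mapping.keys G"
    using keys_mult[of F G] by blast
  have "Poly_Mapping.keys mon \<subseteq> {..<n} \<times> UNIV"
    using assms ab keys_add[of a b] unfolding multidegree_def by blast
  then show "Poly_Mapping.keys mon \<subseteq> {..<n} \<times> UNIV \<and>
     (\<forall>i<n. (\<Sum>v\<in>UNIV. Poly_Mapping.lookup mon (i, v)) = \<delta> i + \<epsilon> i)"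
    using assms ab by (simp add: multidegree_def lookup_add sum.distrib)
qed

lemma multidegree_add:
  "multidegree n \<delta> F \<Longrightarrow> multidegree n \<delta> G \<Longrightarrow> multidegree n \<delta> (F + G)"
  using keys_add[of F G] unfolding multidegree_def by blast

lemma multidegree_diff:
  fixes F G :: "(nat \<times> 'v::finite, 'a::ab_group_add) mpoly"
  shows "multidegree n \<delta> F \<Longrightarrow> multidegree n \<delta> G \<Longrightarrow> multidegree n \<delta> (F - G)"
  using keys_diff[of F G] unfolding multidegree_def by blast

lemma multidegree_zero: "multidegree n \<delta> 0"
  by (simp add: multidegree_def)

lemma multidegree_const: "multidegree n (\<lambda>_. 0) (Poly_Mapping.single 0 c)"
  by (simp add: multidegree_def)

lemma multidegree_one: "multidegree n (\<lambda>_. 0) 1"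
  by (metis multidegree_const single_one)

lemma multidegree_var:
  assumes "j < n"
  shows "multidegree n (\<lambda>i. if i = j then 1 else 0)
    (Poly_Mapping.single (Poly_Mapping.single (j, v::'v::finite) 1) c)"
  using assms by (auto simp: multidegree_def lookup_single when_def)

text \<open>Fraction-free Gaussian elimination: the product of the pivots is a multihomogeneous polynomial
  whose nonvanishing forces the kernel to be trivial, and pivots are chosen nonzero at \<open>x\<close>.\<close>

lemma elimination_certificate:
  fixes r :: "'i \<Rightarrow> 'c \<Rightarrow> (nat \<times> 'v::finite, 'a::field) mpoly"
  assumes "finite C" "\<And>i c. i \<in> I \<Longrightarrow> c \<in> C \<Longrightarrow> multidegree n (\<delta> i) (r i c)"
    and "\<And>w. (\<forall>i\<in>I. (\<Sum>c\<in>C. poly_eval (r i c) x * w c) = 0) \<Longrightarrow> \<forall>c\<in>C. w c = 0"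
  shows "\<exists>P \<epsilon>. multidegree n \<epsilon> P \<and> poly_eval P x \<noteq> 0 \<and>
    (\<forall>y w. poly_eval P y \<noteq> 0 \<longrightarrow> (\<forall>i\<in>I. (\<Sum>c\<in>C. poly_eval (r i c) y * w c) = 0) \<longrightarrow> (\<forall>c\<in>C. w c = 0))"
  using assms
proof (induction C arbitrary: r \<delta> rule: finite_induct)
  case empty
  show ?case by (intro exI[of _ 1] exI conjI) (auto intro: multidegree_one)
next
  case (insert c0 C)
  \<comment> \<open>Otherwise the unit vector at \<open>c0\<close> would be a nonzero kernel vector
    at \<open>x\<close>.\<close>
  have "\<exists>i\<in>I. poly_eval (r i c0) x \<noteq> 0"
  proof (rule ccontr)
    assume "\<not> ?thesis"
    then have "\<forall>i\<in>I. (\<Sum>c\<in>insert c0 C. poly_eval (r i c) x * (if c = c0 then 1 else 0)) = 0"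
      using insert.hyps by (auto intro!: sum.neutral)
    from insert.prems(2)[OF this] show False by simp
  qed
  then obtain i0 where i0: "i0 \<in> I" "poly_eval (r i0 c0) x \<noteq> 0" by blast
  \<comment> \<open>Cross-multiplication keeps the entries polynomial, and both products have
    multidegree the sum of \<open>\<delta> i0\<close> and \<open>\<delta> i\<close>.\<close>
  define r' where "r' i c = r i0 c0 * r i c - r i c0 * r i0 c" for i c
  have sum': "(\<Sum>c\<in>C. poly_eval (r' i c) y * w c)
      = poly_eval (r i0 c0) y * (\<Sum>c\<in>C. poly_eval (r i c) y * w c)
        - poly_eval (r i c0) y * (\<Sum>c\<in>C. poly_eval (r i0 c) y * w c)" for i y w
    by (simp add: r'_def poly_eval_diff poly_eval_mult sum_distrib_left left_diff_distrib
        sum_subtractf mult.assoc)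
  have "\<exists>P \<epsilon>. multidegree n \<epsilon> P \<and> poly_eval P x \<noteq> 0 \<and>
    (\<forall>y w. poly_eval P y \<noteq> 0 \<longrightarrow> (\<forall>i\<in>I. (\<Sum>c\<in>C. poly_eval (r' i c) y * w c) = 0) \<longrightarrow> (\<forall>c\<in>C. w c = 0))"
  proof (rule insert.IH)
    fix i c assume "i \<in> I" "c \<in> C"
    then have "multidegree n (\<lambda>k. \<delta> i0 k + \<delta> i k) (r i0 c0 * r i c)"
      "multidegree n (\<lambda>k. \<delta> i k + \<delta> i0 k) (r i c0 * r i0 c)"
      using insert.prems(1) i0 by (auto intro!: multidegree_mult)
    then show "multidegree n (\<lambda>k. \<delta> i0 k + \<delta> i k) (r' i c)"
      unfolding r'_def by (intro multidegree_diff) (simp_all add: add.commute)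
  next
    fix w assume w: "\<forall>i\<in>I. (\<Sum>c\<in>C. poly_eval (r' i c) x * w c) = 0"
    \<comment> \<open>A kernel vector of the reduced system extends to the original one: equation
      \<open>i0\<close> determines the value at \<open>c0\<close>.\<close>
    define w' where "w' = w(c0 := - (\<Sum>c\<in>C. poly_eval (r i0 c) x * w c) / poly_eval (r i0 c0) x)"
    have "(\<Sum>c\<in>insert c0 C. poly_eval (r i c) x * w' c) = 0" if "i \<in> I" for i
    proof -
      have "(\<Sum>c\<in>C. poly_eval (r i c) x * w' c) = (\<Sum>c\<in>C. poly_eval (r i c) x * w c)"
        using insert.hyps by (intro sum.cong) (auto simp: w'_def)
      moreover have "poly_eval (r i0 c0) x * (\<Sum>c\<in>C. poly_eval (r i c) x * w c)
          = poly_eval (r i c0) x * (\<Sum>c\<in>C. poly_eval (r i0 c) x * w c)"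
        using w that unfolding sum' by simp
      ultimately show ?thesis
        using insert.hyps i0 by (simp add: w'_def field_simps)
    qed
    then have "\<forall>c\<in>insert c0 C. w' c = 0" by (intro insert.prems(2)) blast
    then show "\<forall>c\<in>C. w c = 0" using insert.hyps by (auto simp: w'_def split: if_splits)
  qed
  then obtain P \<epsilon> where P: "multidegree n \<epsilon> P" "poly_eval P x \<noteq> 0"
    "\<And>y w. poly_eval P y \<noteq> 0 \<Longrightarrow> \<forall>i\<in>I. (\<Sum>c\<in>C. poly_eval (r' i c) y * w c) = 0 \<Longrightarrow> \<forall>c\<in>C. w c = 0"
    by blast
  show ?case
  proof (intro exI[of _ "r i0 c0 * P"] exI conjI allI impI)
    show "multidegree n (\<lambda>k. \<delta> i0 k + \<epsilon> k) (r i0 c0 * P)"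
      using P(1) insert.prems(1) i0 by (intro multidegree_mult) auto
    show "poly_eval (r i0 c0 * P) x \<noteq> 0"
      using P(2) i0 by (simp add: poly_eval_mult)
    fix y w
    assume "poly_eval (r i0 c0 * P) y \<noteq> 0"
      and w: "\<forall>i\<in>I. (\<Sum>c\<in>insert c0 C. poly_eval (r i c) y * w c) = 0"
    then have y: "poly_eval (r i0 c0) y \<noteq> 0" "poly_eval P y \<noteq> 0" by (auto simp: poly_eval_mult)
    have w2: "(\<Sum>c\<in>C. poly_eval (r i c) y * w c) = - (poly_eval (r i c0) y * w c0)" if "i \<in> I" for i
      using w that insert.hyps by (simp add: eq_neg_iff_add_eq_0 add.commute)
    have wC: "\<forall>c\<in>C. w c = 0"
      by (rule P(3)[OF y(2)]) (simp add: sum' w2 i0)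
    moreover have "poly_eval (r i0 c0) y * w c0 = 0"
      using w2[OF i0(1)] wC by simp
    ultimately show "\<forall>c\<in>insert c0 C. w c = 0" using y by simp
  qed
qed

section \<open>Taylor coefficients as polynomials in the points\<close>

text \<open>The function \<open>g\<close> will be \<open>(x, t) \<mapsto> mon (x\<^sub>j + t y)\<close>; its coefficient at \<open>t\<^sup>i\<close> is a form of degree
  \<open>d - i\<close> in the coordinates of the \<open>j\<close>-th point alone.\<close>

definition taylor_expandable ::
    "nat \<Rightarrow> nat \<Rightarrow> nat \<Rightarrow> ((nat \<times> 'v::finite \<Rightarrow> 'a::field) \<Rightarrow> 'a \<Rightarrow> 'a) \<Rightarrow> bool" where
  "taylor_expandable n j d g \<longleftrightarrow> (\<exists>E :: nat \<Rightarrow> (nat \<times> 'v, 'a) mpoly.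
     (\<forall>i\<le>d. multidegree n (\<lambda>l. if l = j then d - i else 0) (E i)) \<and>
     (\<forall>x t. g x t = (\<Sum>i\<le>d. poly_eval (E i) x * t ^ i)))"

lemma taylor_expandable_one: "taylor_expandable n j 0 (\<lambda>_ _. 1)"
proof -
  have "(\<lambda>l. if l = j then 0 - i else 0) = (\<lambda>_. 0 :: nat)" for i :: nat
    by auto
  then show ?thesis
    unfolding taylor_expandable_def
    by (intro exI[of _ "\<lambda>_. 1"]) (simp only: multidegree_one, simp)
qed

lemma taylor_expandable_step:
  assumes "j < n" "taylor_expandable n j d g"
  shows "taylor_expandable n j (Suc d) (\<lambda>x t. (x (j, v) + t * c) * g x t)"
proof -
  obtain E where E: "\<And>i. i \<le> d \<Longrightarrow> multidegree n (\<lambda>l. if l = j then d - i else 0) (E i)"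
    "\<And>x t. g x t = (\<Sum>i\<le>d. poly_eval (E i) x * t ^ i)"
    using assms(2) unfolding taylor_expandable_def by blast
  let ?X = "Poly_Mapping.single (Poly_Mapping.single (j, v) 1) 1 :: (nat \<times> 'a, 'b) mpoly"
  \<comment> \<open>The new coefficient of \<open>t ^ i\<close> is the variable times
    \<open>E i\<close> (part \<open>A\<close>) plus \<open>c\<close> times \<open>E (i - 1)\<close>
    (part \<open>B\<close>), both of degree \<open>Suc d - i\<close>. \<open>A\<close> is cut off at
    \<open>i = Suc d\<close>, where \<open>E\<close> is unconstrained.\<close>
  define A where "A i = (if i \<le> d then ?X * E i else 0)" for i
  define B where "B i = (if i = 0 then 0 else Poly_Mapping.single 0 c * E (i - 1))" for i
  have "multidegree n (\<lambda>l. if l = j then Suc d - i else 0) (A i + B i)" if i: "i \<le> Suc d" for i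
  proof (rule multidegree_add)
    show "multidegree n (\<lambda>l. if l = j then Suc d - i else 0) (A i)"
    proof (cases "i \<le> d")
      case True
      have "multidegree n (\<lambda>l. (if l = j then 1 else 0) + (if l = j then d - i else 0)) (?X * E i)"
        by (intro multidegree_mult multidegree_var E assms True)
      moreover have "(\<lambda>l. (if l = j then 1 :: nat else 0) + (if l = j then d - i else 0))
          = (\<lambda>l. if l = j then Suc d - i else 0)"
        using True by (intro ext) (simp add: Suc_diff_le)
      ultimately show ?thesis using True by (simp add: A_def)
    qed (simp add: A_def multidegree_zero)
    show "multidegree n (\<lambda>l. if l = j then Suc d - i else 0) (B i)"
    proof (cases i)
      case (Suc i')
      have "multidegree n (\<lambda>l. 0 + (if l = j then d - i' else 0)) (Poly_Mapping.single 0 c * E i')"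
        using i Suc by (intro multidegree_mult multidegree_const E) simp
      then show ?thesis using Suc by (simp add: B_def cong: if_cong)
    qed (simp add: B_def multidegree_zero)
  qed
  moreover have "(x (j, v) + t * c) * g x t = (\<Sum>i\<le>Suc d. poly_eval (A i + B i) x * t ^ i)" for x t
  proof -
    have "(\<Sum>i\<le>Suc d. poly_eval (A i) x * t ^ i) = x (j, v) * g x t"
      by (simp add: A_def E(2) poly_eval_mult poly_eval_single mon_eval_single sum_distrib_left
          mult.assoc)
    moreover have "(\<Sum>i\<le>Suc d. poly_eval (B i) x * t ^ i) = t * c * g x t"
      unfolding sum.atMost_Suc_shift
      by (simp add: B_def E(2) poly_eval_mult poly_eval_single sum_distrib_left algebra_simps)
    ultimately show ?thesis
      by (simp only: poly_eval_add distrib_right sum.distrib)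
  qed
  ultimately show ?thesis
    unfolding taylor_expandable_def by (intro exI[of _ "\<lambda>i. A i + B i"]) blast
qed

lemma taylor_expandable_mon_eval:
  fixes mon :: "'v::finite \<Rightarrow>\<^sub>0 nat" and y :: "'v \<Rightarrow> 'a::field"
  assumes "j < n" "mon \<in> monomials_of_degree d"
  shows "taylor_expandable n j d (\<lambda>x t. mon_eval mon (\<lambda>v. x (j, v) + t * y v))"
proof -
  have "taylor_expandable n j (\<Sum>v\<in>A. k v) (\<lambda>x t. \<Prod>v\<in>A. (x (j, v) + t * y v) ^ k v)"
    if "finite A" for A :: "'v set" and k
    using that
  proof induction
    case empty
    show ?case by (simp add: taylor_expandable_one)
  next
    case (insert v A)
    have "taylor_expandable n j (l + (\<Sum>v\<in>A. k v))
        (\<lambda>x t. (x (j, v) + t * y v) ^ l * (\<Prod>v\<in>A. (x (j, v) + t * y v) ^ k v))" for l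
    proof (induction l)
      case 0
      show ?case using insert.IH by simp
    next
      case (Suc l)
      from taylor_expandable_step[OF assms(1) this, of v "y v"]
      show ?case by (simp add: mult.assoc)
    qed
    then show ?case using insert.hyps by simp
  qed
  from this[of UNIV "Poly_Mapping.lookup mon"] assms(2) show ?thesis
    by (simp add: mon_eval_superset[of UNIV] monomials_of_degree_def)
qed

section \<open>Powers of the ideal of a point\<close>

lemma module_mult: "module ((*) :: 'r::comm_ring_1 \<Rightarrow> 'r \<Rightarrow> 'r)"
  by unfold_locales (simp_all add: algebra_simps)

lemma ideal_generated_base: "f \<in> S \<Longrightarrow> f \<in> ideal_generated S"
  unfolding ideal_generated_def by (rule module.span_base[OF module_mult])

lemma ideal_generated_mult: "f \<in> ideal_generated S \<Longrightarrow> g * f \<in> ideal_generated S"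
  unfolding ideal_generated_def by (rule module.span_scale[OF module_mult])

lemma zero_in_ideal_generated: "0 \<in> ideal_generated S"
  unfolding ideal_generated_def by (rule module.span_zero[OF module_mult])

lemma ideal_generated_induct [consumes 1, case_names base zero add mult]:
  assumes "f \<in> ideal_generated S" "\<And>f. f \<in> S \<Longrightarrow> P f" "P 0"
    "\<And>f g. P f \<Longrightarrow> P g \<Longrightarrow> P (f + g)" "\<And>f g. P f \<Longrightarrow> P (g * f)"
  shows "P f"
proof (rule module.span_induct[OF module_mult])
  show "f \<in> module.span (*) S" using assms(1) by (simp add: ideal_generated_def)
  show "module.subspace (*) (Collect P)"
    using assms(3-5) by (intro module.subspaceI[OF module_mult]) auto
qed (rule assms(2))

lemma ideal_power_mult: "f \<in> ideal_power J e \<Longrightarrow> g * f \<in> ideal_power J e"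
  by (cases e) (auto intro: ideal_generated_mult)

lemma zero_in_ideal_power: "0 \<in> ideal_power J e"
  by (cases e) (auto intro: zero_in_ideal_generated)

lemma power_in_ideal_power: "f \<in> J \<Longrightarrow> f ^ e \<in> ideal_power J e"
  by (induction e) (auto intro: ideal_generated_base)

section \<open>Order along lines for elements of ideal powers\<close>

definition line_order :: "nat \<Rightarrow> ('v, 'a::comm_ring_1) mpoly \<Rightarrow> ('v \<Rightarrow> 'a) \<Rightarrow> ('v \<Rightarrow> 'a) \<Rightarrow> bool" where
  "line_order e f x y \<longleftrightarrow> (\<exists>p. \<forall>t. poly_eval f (\<lambda>v. x v + t * y v) = t ^ e * poly p t)"

lemma line_order_zero: "line_order 0 f x y"
  unfolding line_order_def using poly_eval_line by simp

lemma line_order_0: "line_order e 0 x y"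
  by (auto simp: line_order_def intro: exI[of _ 0])

lemma line_order_add:
  assumes "line_order e f x y" "line_order e g x y"
  shows "line_order e (f + g) x y"
proof -
  obtain p q where "\<And>t. poly_eval f (\<lambda>v. x v + t * y v) = t ^ e * poly p t"
    "\<And>t. poly_eval g (\<lambda>v. x v + t * y v) = t ^ e * poly q t"
    using assms unfolding line_order_def by blast
  then show ?thesis
    unfolding line_order_def by (intro exI[of _ "p + q"]) (simp add: poly_eval_add distrib_left)
qed

lemma line_order_mult:
  assumes "line_order e f x y" "line_order e' g x y"
  shows "line_order (e + e') (f * g) x y"
proof -
  obtain p q where "\<And>t. poly_eval f (\<lambda>v. x v + t * y v) = t ^ e * poly p t"
    "\<And>t. poly_eval g (\<lambda>v. x v + t * y v) = t ^ e' * poly q t"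
    using assms unfolding line_order_def by blast
  then show ?thesis
    unfolding line_order_def
    by (intro exI[of _ "p * q"]) (simp add: poly_eval_mult power_add algebra_simps)
qed

lemma point_ideal_line_order:
  fixes q :: "('a::field ^ 'v) set"
  assumes "f \<in> \<mm> q" "x \<in> q"
  shows "line_order 1 f (\<lambda>v. x $ v) y"
  using assms(1) unfolding point_ideal_def
proof (induction rule: ideal_generated_induct)
  case (base f)
  obtain p where p: "\<And>t. poly_eval f (\<lambda>v. x $ v + t * y v) = poly p t"
    using poly_eval_line by blast
  have "poly p 0 = 0"
    using base assms(2) p[of 0] by (simp add: vanishes_at_point_def)
  then obtain r where "p = [:0, 1:] * r"
    using poly_eq_0_iff_dvd[of p 0] by auto
  then show ?case
    unfolding line_order_def using p by (intro exI[of _ r]) simp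
next
  case (mult f g)
  then show ?case using line_order_mult[OF line_order_zero] by fastforce
qed (auto intro: line_order_0 line_order_add)

text \<open>Orders along a line add under products and survive sums and multiples, so order at least
  \<open>1\<close> on \<open>\<mm> q\<close> gives order at least \<open>e\<close> on its
  \<open>e\<close>-th power.\<close>

lemma ideal_power_line_order:
  fixes q :: "('a::field ^ 'v) set"
  assumes "f \<in> ideal_power (\<mm> q) e" "x \<in> q"
  shows "line_order e f (\<lambda>v. x $ v) y"
  using assms(1)
proof (induction e arbitrary: f)
  case 0
  show ?case by (rule line_order_zero)
next
  case (Suc e)
  from Suc.prems show ?case unfolding ideal_power.simps
  proof (induction rule: ideal_generated_induct)
    case (base f)
    then show ?case
      using line_order_mult[OF point_ideal_line_order[OF _ assms(2)] Suc.IH] by fastforce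
  next
    case (mult f g)
    then show ?case using line_order_mult[OF line_order_zero] by fastforce
  qed (auto intro: line_order_0 line_order_add)
qed

section \<open>From a special to a general configuration\<close>

lemma nonvanishing_locus_open:
  assumes "multihomogeneous n P"
  shows "zariski_open n {p \<in> proj_tuples n. \<not> vanishes_at_tuple n P p}"
  unfolding zariski_open_def zariski_closed_def using assms
  by (intro conjI exI[of _ "{P}"]) auto

text \<open>Semicontinuity: the coefficients of a form of degree \<open>d\<close> with order
  \<open>e\<close> at the points solve a linear system whose entries are multihomogeneous in the
  points. A trivial kernel at \<open>X\<close> is certified by one polynomial \<open>P\<close>, and
  the nonvanishing locus of \<open>P\<close> is the open set.\<close>

lemma generic_emptiness:
  fixes X :: "nat \<Rightarrow> 'a::field_char_0 ^ 'v::finite"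
  assumes X: "\<And>j. j < n \<Longrightarrow> X j \<noteq> 0"
    and special: "\<And>F. homogeneous_of_degree d F \<Longrightarrow>
      (\<And>j y. j < n \<Longrightarrow> line_order e F (\<lambda>v. X j $ v) y) \<Longrightarrow> F = 0"
  shows "\<exists>U :: (nat \<Rightarrow> ('a ^ 'v) set) set. zariski_open n U \<and> U \<noteq> {} \<and>
    (\<forall>p\<in>U. \<forall>F. F \<in> points_symbolic_power n p e \<longrightarrow> homogeneous_of_degree d F \<longrightarrow> F = 0)"
proof -
  let ?M = "monomials_of_degree d :: ('v \<Rightarrow>\<^sub>0 nat) set"
  \<comment> \<open>The side conditions sit inside \<open>\<Phi>\<close> as implications, so that a
    total choice function exists.\<close>
  define \<Phi> where "\<Phi> = (\<lambda>(j, mon, y :: 'v \<Rightarrow> 'a) (E :: nat \<Rightarrow> (nat \<times> 'v, 'a) mpoly).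
     j < n \<longrightarrow> mon \<in> ?M \<longrightarrow>
     (\<forall>i\<le>d. multidegree n (\<lambda>l. if l = j then d - i else 0) (E i)) \<and>
     (\<forall>x t. mon_eval mon (\<lambda>v. x (j, v) + t * y v) = (\<Sum>i\<le>d. poly_eval (E i) x * t ^ i)))"
  have "\<exists>E. \<Phi> (j, mon, y) E" for j mon y
    using taylor_expandable_mon_eval[of j n mon d y]
    unfolding taylor_expandable_def \<Phi>_def by auto
  then have "\<forall>q. \<exists>E. \<Phi> q E" by auto
  then obtain E' where E': "\<And>q. \<Phi> q (E' q)" by (blast dest: choice)
  obtain E :: "nat \<Rightarrow> ('v \<Rightarrow>\<^sub>0 nat) \<Rightarrow> ('v \<Rightarrow> 'a) \<Rightarrow> nat \<Rightarrow> (nat \<times> 'v, 'a) mpoly" where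
    E: "\<And>j mon y i. j < n \<Longrightarrow> mon \<in> ?M \<Longrightarrow> i \<le> d \<Longrightarrow>
        multidegree n (\<lambda>l. if l = j then d - i else 0) (E j mon y i)"
      "\<And>j mon y x t. j < n \<Longrightarrow> mon \<in> ?M \<Longrightarrow>
        mon_eval mon (\<lambda>v. x (j, v) + t * y v) = (\<Sum>i\<le>d. poly_eval (E j mon y i) x * t ^ i)"
  proof
    show "multidegree n (\<lambda>l. if l = j then d - i else 0) (E' (j, mon, y) i)"
      if "j < n" "mon \<in> ?M" "i \<le> d" for j mon y i
      using E'[of "(j, mon, y)"] that unfolding \<Phi>_def by auto
    show "mon_eval mon (\<lambda>v. x (j, v) + t * y v) = (\<Sum>i\<le>d. poly_eval (E' (j, mon, y) i) x * t ^ i)"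
      if "j < n" "mon \<in> ?M" for j mon y x t
      using E'[of "(j, mon, y)"] that unfolding \<Phi>_def by auto
  qed
  \<comment> \<open>Equation \<open>(j, y, i)\<close> says that the coefficient of
    \<open>t ^ i\<close> along direction \<open>y\<close> at the \<open>j\<close>-th point is zero.
    All directions occur, so the system may be infinite; only the unknowns must be finite in number
    for \<open>elimination_certificate\<close>.\<close>
  define I :: "(nat \<times> ('v \<Rightarrow> 'a) \<times> nat) set" where "I = {(j, y, i). j < n \<and> i < e \<and> i \<le> d}"
  define r where "r = (\<lambda>(j, y, i) mon. E j mon y i)"
  have expand: "poly_eval F (\<lambda>v. x (j, v) + t * y v)
      = (\<Sum>i\<le>d. (\<Sum>mon\<in>?M. poly_eval (E j mon y i) x * Poly_Mapping.lookup F mon) * t ^ i)"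
    if "homogeneous_of_degree d F" "j < n" for F x j t and y :: "'v \<Rightarrow> 'a"
  proof -
    have "poly_eval F (\<lambda>v. x (j, v) + t * y v)
        = (\<Sum>mon\<in>?M. \<Sum>i\<le>d. poly_eval (E j mon y i) x * Poly_Mapping.lookup F mon * t ^ i)"
      unfolding homogeneous_of_degree_sum_monomials[OF that(1)]
      by (intro sum.cong refl) (simp add: E(2)[OF that(2)] sum_distrib_left mult_ac)
    then show ?thesis
      by (subst (asm) sum.swap) (simp add: sum_distrib_right)
  qed
  have "\<exists>P \<epsilon>. multidegree n \<epsilon> P \<and> poly_eval P (\<lambda>(j, v). X j $ v) \<noteq> 0 \<and>
    (\<forall>y w. poly_eval P y \<noteq> 0 \<longrightarrow> (\<forall>i\<in>I. (\<Sum>mon\<in>?M. poly_eval (r i mon) y * w mon) = 0) \<longrightarrow>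
      (\<forall>mon\<in>?M. w mon = 0))"
  proof (rule elimination_certificate[where \<delta> = "\<lambda>(j, y, i) l. if l = j then d - i else 0"])
    show "finite ?M" by (rule card_monomials_of_degree)
    show "multidegree n ((\<lambda>(j, y, i) l. if l = j then d - i else 0) i) (r i mon)"
      if "i \<in> I" "mon \<in> ?M" for i mon
      using that E(1) by (auto simp: I_def r_def)
    fix w :: "('v \<Rightarrow>\<^sub>0 nat) \<Rightarrow> 'a"
    assume w: "\<forall>i\<in>I. (\<Sum>mon\<in>?M. poly_eval (r i mon) (\<lambda>(j, v). X j $ v) * w mon) = 0"
    let ?F = "form_of_coeffs d w"
    have "?F = 0"
    proof (rule special)
      show "homogeneous_of_degree d ?F" by (rule homogeneous_form_of_coeffs)
      fix j and y :: "'v \<Rightarrow> 'a" assume j: "j < n"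
      define c where "c i = (\<Sum>mon\<in>?M. poly_eval (E j mon y i) (\<lambda>(j, v). X j $ v) * w mon)" for i
      have c0: "c i = 0" if "i < e" "i \<le> d" for i
        using bspec[OF w, of "(j, y, i)"] that j by (simp add: I_def r_def c_def)
      have "poly_eval ?F (\<lambda>v. X j $ v + t * y v) = t ^ e * poly (\<Sum>i\<in>{e..d}. monom (c i) (i - e)) t" for t
      proof -
        have "poly_eval ?F (\<lambda>v. X j $ v + t * y v) = (\<Sum>i\<le>d. c i * t ^ i)"
          using expand[OF homogeneous_form_of_coeffs j, of w "\<lambda>(j, v). X j $ v" t y]
          by (simp add: c_def lookup_form_of_coeffs)
        also have "\<dots> = (\<Sum>i\<in>{e..d}. c i * t ^ i)"
          by (rule sum.mono_neutral_right) (auto simp: c0)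
        also have "\<dots> = (\<Sum>i\<in>{e..d}. t ^ e * (c i * t ^ (i - e)))"
          by (intro sum.cong) (auto simp: mult.left_commute simp flip: power_add)
        finally show ?thesis by (simp add: poly_sum poly_monom sum_distrib_left)
      qed
      then show "line_order e ?F (\<lambda>v. X j $ v) y" unfolding line_order_def by blast
    qed
    then show "\<forall>mon\<in>?M. w mon = 0"
      using lookup_form_of_coeffs[of _ d w] by force
  qed
  then obtain P \<epsilon> where P: "multidegree n \<epsilon> P" "poly_eval P (\<lambda>(j, v). X j $ v) \<noteq> 0"
    "\<And>y w. poly_eval P y \<noteq> 0 \<Longrightarrow> \<forall>i\<in>I. (\<Sum>mon\<in>?M. poly_eval (r i mon) y * w mon) = 0 \<Longrightarrow>
      \<forall>mon\<in>?M. w mon = 0"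
    by blast
  let ?U = "{p \<in> proj_tuples n. \<not> vanishes_at_tuple n P p}"
  let ?p = "\<lambda>j\<in>{..<n}. vec.span {X j}"
  have "?p \<in> proj_tuples n"
    using X unfolding proj_tuples_def proj_space_def by auto
  moreover have "\<not> vanishes_at_tuple n P ?p"
    using P(2) unfolding vanishes_at_tuple_def
    by (auto intro!: exI[of _ X] vec.span_base)
  ultimately have "?U \<noteq> {}" by blast
  moreover have "F = 0"
    if p: "p \<in> ?U" and F: "F \<in> points_symbolic_power n p e" "homogeneous_of_degree d F" for p F
  proof -
    obtain x where x: "\<And>j. j < n \<Longrightarrow> x j \<in> p j" "poly_eval P (\<lambda>(j, v). x j $ v) \<noteq> 0"
      using p unfolding vanishes_at_tuple_def by blast
    have "\<forall>i\<in>I. (\<Sum>mon\<in>?M. poly_eval (r i mon) (\<lambda>(j, v). x j $ v) * Poly_Mapping.lookup F mon) = 0"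
    proof
      fix i' assume "i' \<in> I"
      then obtain j y i where i': "i' = (j, y, i)" "j < n" "i < e" "i \<le> d"
        by (auto simp: I_def)
      define c where "c i = (\<Sum>mon\<in>?M. poly_eval (E j mon y i) (\<lambda>(j, v). x j $ v) * Poly_Mapping.lookup F mon)" for i
      have "F \<in> ideal_power (\<mm> (p j)) e"
        using F(1) i' by (auto simp: points_symbolic_power_def)
      then have "line_order e F (\<lambda>v. x j $ v) y"
        using x(1) i' by (intro ideal_power_line_order)
      then obtain q where q: "\<And>t. poly_eval F (\<lambda>v. x j $ v + t * y v) = t ^ e * poly q t"
        unfolding line_order_def by blast
      \<comment> \<open>Two univariate polynomials agree as functions, hence coefficientwise, and
        the right one has no terms below \<open>t ^ e\<close>.\<close>
      have "poly (\<Sum>i\<le>d. monom (c i) i) t = poly (monom 1 e * q) t" for t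
        using expand[OF F(2) i'(2), of "\<lambda>(j, v). x j $ v" t y] q[of t]
        by (simp add: c_def poly_sum poly_monom)
      then have "(\<Sum>i\<le>d. monom (c i) i) = monom 1 e * q" by (rule poly_ext)
      then have "monom 1 e dvd (\<Sum>i\<le>d. monom (c i) i)" by simp
      then have "coeff (\<Sum>i\<le>d. monom (c i) i) i = 0"
        using i' unfolding monom_1_dvd_iff' by blast
      then have "c i = 0" using i' by (simp add: coeff_sum)
      then show "(\<Sum>mon\<in>?M. poly_eval (r i' mon) (\<lambda>(j, v). x j $ v) * Poly_Mapping.lookup F mon) = 0"
        by (simp add: r_def i' c_def)
    qed
    from P(3)[OF x(2) this] have "poly_eval F z = 0" for z
      by (simp add: homogeneous_of_degree_sum_monomials[OF F(2)])
    then show ?thesis by (rule poly_eval_eq_zeroD)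
  qed
  moreover have "zariski_open n ?U"
    by (rule nonvanishing_locus_open[OF multidegree_imp_multihomogeneous[OF P(1)]])
  ultimately show ?thesis
    by (intro exI[of _ ?U]) simp
qed

section \<open>Bounds on the initial degree\<close>

lemma initial_degree_le:
  assumes "F \<in> J" "homogeneous_of_degree d F" "F \<noteq> 0"
  shows "\<alpha> J \<le> d"
  unfolding initial_degree_def using assms
  by (intro Least_le) (auto simp: graded_part_def)

text \<open>A nonzero form of degree at most \<open>d\<close> in \<open>J\<close> could be
  multiplied by a power of a variable to reach degree \<open>d\<close> exactly. The form
  \<open>F0\<close> guarantees that the least degree is attained.\<close>

lemma initial_degree_greater:
  fixes J :: "('v::{finite, linorder}, 'a::field_char_0) mpoly set"
  assumes "F0 \<in> J" "homogeneous_of_degree d0 F0" "F0 \<noteq> 0"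
    and ideal: "0 \<in> J" "\<And>F G. F \<in> J \<Longrightarrow> G * F \<in> J"
    and empty: "\<And>F. F \<in> J \<Longrightarrow> homogeneous_of_degree d F \<Longrightarrow> F = 0"
  shows "d < \<alpha> J"
proof (rule ccontr)
  assume "\<not> d < \<alpha> J"
  have "graded_part J (\<alpha> J) \<noteq> {0}"
    unfolding initial_degree_def
    by (rule LeastI[of _ d0]) (use assms(1-3) in \<open>auto simp: graded_part_def\<close>)
  moreover have "0 \<in> graded_part J (\<alpha> J)"
    using ideal(1) by (simp add: graded_part_def homogeneous_of_degree_def)
  ultimately obtain F where F: "F \<in> J" "homogeneous_of_degree (\<alpha> J) F" "F \<noteq> 0"
    by (auto simp: graded_part_def)
  define G :: "('v, 'a) mpoly"
    where "G = Poly_Mapping.single (Poly_Mapping.single undefined (d - \<alpha> J)) 1"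
  have "homogeneous_of_degree (d - \<alpha> J) G"
    unfolding G_def by (rule homogeneous_of_degree_single) (simp add: lookup_single when_def)
  from homogeneous_of_degree_mult[OF this F(2)] have "homogeneous_of_degree d (G * F)"
    using \<open>\<not> d < \<alpha> J\<close> by simp
  then have "G * F = 0" using empty ideal(2) F(1) by blast
  moreover have "G \<noteq> 0"
    unfolding G_def by (metis keys_single keys_zero insert_not_empty one_neq_zero)
  ultimately show False using F(3) by simp
qed

text \<open>Vanishing at \<open>n\<close> points imposes \<open>n\<close> linear conditions on the
  \<open>(a + 3) choose 3\<close> coefficients of a form.\<close>

lemma form_in_points_ideal:
  fixes p :: "nat \<Rightarrow> ('a::field_char_0 ^ 4) set"
  assumes "p \<in> proj_tuples n" "n < (a + 3) choose 3"
  shows "\<exists>F. F \<in> points_ideal n p \<and> homogeneous_of_degree a F \<and> F \<noteq> 0"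
proof -
  have "\<forall>j. \<exists>z. j < n \<longrightarrow> p j = vec.span {z}"
    using assms(1) by (force simp: proj_tuples_def proj_space_def PiE_def Pi_def)
  then obtain z where z: "\<And>j. j < n \<Longrightarrow> p j = vec.span {z j}" by metis
  let ?M = "monomials_of_degree a :: (4 \<Rightarrow>\<^sub>0 nat) set"
  have "card ?M = (a + 3) choose 3"
    using card_monomials_of_degree(2)[of a, where 'v = 4] binomial_symmetric[of 3 "a + 3"]
    by (simp add: eval_nat_numeral)
  then have "card {..<n} < card ?M" using assms(2) by simp
  from underdetermined_solution[OF finite_lessThan card_monomials_of_degree(1) this,
      of "\<lambda>j mon. mon_eval mon (\<lambda>v. z j $ v)"]
  obtain w mon where w: "mon \<in> ?M" "w mon \<noteq> 0"
    "\<And>j. j < n \<Longrightarrow> (\<Sum>mon\<in>?M. mon_eval mon (\<lambda>v. z j $ v) * w mon) = 0"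
    by auto
  let ?F = "form_of_coeffs a w"
  have hom: "homogeneous_of_degree a ?F" by (rule homogeneous_form_of_coeffs)
  have "?F \<in> \<mm> (p j)" if j: "j < n" for j
  proof -
    have 0: "poly_eval ?F (\<lambda>v. z j $ v) = 0"
      using w(3)[OF j] by (simp add: poly_eval_form_of_coeffs mult.commute)
    \<comment> \<open>By homogeneity, vanishing at one representative spreads to the whole
      line.\<close>
    have "poly_eval ?F (\<lambda>v. x $ v) = 0" if x: "x \<in> p j" for x
    proof -
      obtain c where "x = c *s z j"
        using x z[OF j] by (auto simp: vec.span_singleton)
      then show ?thesis
        using poly_eval_homogeneous_scale[OF hom, of c "\<lambda>v. z j $ v"] 0 by simp
    qed
    then show ?thesis
      unfolding point_ideal_def using hom
      by (intro ideal_generated_base) (auto simp: vanishes_at_point_def homogeneous_def)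
  qed
  moreover have "?F \<noteq> 0" using w lookup_form_of_coeffs[OF w(1), of w] by auto
  ultimately show ?thesis
    using hom by (auto simp: points_ideal_def)
qed

section \<open>The star configuration in projective 3-space\<close>

lemma form_fun_poly_eval:
  fixes F :: "('v::finite, 'a::field_char_0) mpoly"
  assumes "homogeneous_of_degree d F"
  shows "form_fun d (\<lambda>x. poly_eval F (\<lambda>v. coeff x (g v)))"
proof -
  have mon: "form_fun (\<Sum>v\<in>A. k v) (\<lambda>x. \<Prod>v\<in>A. coeff x (g v) ^ k v)"
    if "finite A" for A and k :: "'v \<Rightarrow> nat"
    using that
  proof induction
    case empty
    show ?case using form_fun.const[of 1] by simp
  next
    case (insert v A)
    have "lin_fun (\<lambda>x. coeff x (g v))" by (simp add: lin_fun_def)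
    from form_fun_mult_power[OF this insert.IH] show ?case using insert.hyps by simp
  qed
  have "form_fun d (\<lambda>x. \<Sum>mon\<in>monomials_of_degree d.
      Poly_Mapping.lookup F mon * mon_eval mon (\<lambda>v. coeff x (g v)))"
  proof (intro form_fun_sum form_fun_cmult)
    fix mon :: "'v \<Rightarrow>\<^sub>0 nat" assume "mon \<in> monomials_of_degree d"
    then show "form_fun d (\<lambda>x. mon_eval mon (\<lambda>v. coeff x (g v)))"
      using mon[of UNIV "Poly_Mapping.lookup mon"]
      by (simp add: mon_eval_superset[of UNIV] monomials_of_degree_def)
  qed
  then show ?thesis by (simp add: homogeneous_of_degree_sum_monomials[OF assms])
qed

text \<open>Carries \<open>star_vanishing\<close> with \<open>N = 3\<close> over to coordinates: a
  bijection \<open>g\<close> matches the four coordinates with the coefficients of a polynomial of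
  degree at most 3.\<close>

lemma star_configuration_empty:
  fixes S :: "'a::field_char_0 set"
  assumes S: "finite S" "3 \<le> card S" and n: "card S choose 3 \<le> n"
    and bound: "3 * m < e + 3" "d < m * (card S - 3) + e"
  shows "\<exists>X :: nat \<Rightarrow> 'a ^ 4. (\<forall>j<n. X j \<noteq> 0) \<and>
    (\<forall>F. homogeneous_of_degree d F \<longrightarrow>
      (\<forall>j<n. \<forall>y. line_order e F (\<lambda>v. X j $ v) y) \<longrightarrow> F = 0)"
proof -
  obtain g :: "4 \<Rightarrow> nat" where g: "bij_betw g UNIV {0..<4}"
    using ex_bij_betw_finite_nat[of "UNIV :: 4 set"] by auto
  have g3: "g v \<le> 3" for v
    using bij_betwE[OF g] by (force simp: less_Suc_eq_le numeral_eq_Suc)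
  let ?Bs = "{B. B \<subseteq> S \<and> card B = 3}"
  have card: "card ?Bs = card S choose 3" using n_subsets[OF S(1)] by simp
  have "finite ?Bs" using S by simp
  then obtain h0 where h0: "bij_betw h0 {0..<card ?Bs} ?Bs" using ex_bij_betw_nat_finite by blast
  obtain B0 where B0: "B0 \<in> ?Bs" using obtain_subset_with_card_n[OF S(2)] by blast
  \<comment> \<open>All triples are listed first; when \<open>n\<close> exceeds their number,
    \<open>B0\<close> fills the remaining places.\<close>
  define h where "h j = (if j < card ?Bs then h0 j else B0)" for j
  have h: "h j \<in> ?Bs" for j using h0 B0 by (auto simp: h_def bij_betw_def)
  define P :: "'a set \<Rightarrow> 'a poly" where "P B = (\<Prod>b\<in>B. [:- b, 1:])" for B
  define X :: "nat \<Rightarrow> 'a ^ 4" where "X j = (\<chi> v. coeff (P (h j)) (g v))" for j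
  have "X j \<noteq> 0" for j
  proof -
    have fin: "finite (h j)" using h[of j] S finite_subset by auto
    \<comment> \<open>The leading coefficient supplies a nonzero coordinate.\<close>
    have "degree (P (h j)) = 3"
      unfolding P_def using h[of j] by (subst degree_prod_eq_sum_degree) auto
    moreover have "P (h j) \<noteq> 0" using fin by (simp add: P_def)
    ultimately have "coeff (P (h j)) 3 \<noteq> 0" by (metis leading_coeff_0_iff)
    moreover have "3 \<in> range g" using g by (simp add: bij_betw_def)
    then obtain v where "g v = 3" by force
    ultimately have "X j $ v \<noteq> 0" by (simp add: X_def)
    then show ?thesis by auto
  qed
  moreover have "F = 0" if hom: "homogeneous_of_degree d F"
    and ord: "\<forall>j<n. \<forall>y. line_order e F (\<lambda>v. X j $ v) y" for F
  proof (rule poly_eval_eq_zeroD)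
    fix z :: "4 \<Rightarrow> 'a"
    define x where "x = (\<Sum>v\<in>UNIV. monom (z v) (g v))"
    have "coeff x (g v) = z v" for v
    proof -
      have "coeff x (g v) = (\<Sum>v'\<in>UNIV. if v' = v then z v' else 0)"
        unfolding x_def coeff_sum coeff_monom
        using g by (intro sum.cong) (auto simp: bij_betw_def inj_on_def)
      then show ?thesis by simp
    qed
    moreover have "poly_eval F (\<lambda>v. coeff x (g v)) = 0"
    proof (rule star_vanishing[OF S form_fun_poly_eval[OF hom], where e = e and m = m])
      show "degree x \<le> 3"
        unfolding x_def by (intro degree_sum_le order.trans[OF degree_monom_le g3]) auto
      fix B y assume B: "B \<subseteq> S" "card B = 3"
      then have "B \<in> h0 ` {0..<card ?Bs}" using h0 by (auto simp: bij_betw_def)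
      then obtain j where "j < card ?Bs" "h0 j = B" by auto
      then have j: "j < n" "h j = B" using n card by (auto simp: h_def)
      have "line_order e F (\<lambda>v. X j $ v) (\<lambda>v. coeff y (g v))" using ord j(1) by blast
      then show "vanish_order e (\<lambda>x. poly_eval F (\<lambda>v. coeff x (g v))) (\<Prod>b\<in>B. [:- b, 1:]) y"
        unfolding line_order_def vanish_order_def by (simp add: X_def j(2) P_def)
    qed (use bound in auto)
    ultimately show "poly_eval F z = 0" by simp
  qed
  ultimately show ?thesis by blast
qed

section \<open>Choice of parameters and conclusion\<close>

lemma less_choose_three: "n < (n + 3) choose 3"
proof (induction n)
  case (Suc n)
  have "0 < (n + 3) choose 2" by simp
  moreover have "(Suc n + 3) choose 3 = ((n + 3) choose 2) + ((n + 3) choose 3)"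
    using binomial_Suc_Suc[of "n + 3" 2] by (simp add: numeral_3_eq_3)
  ultimately show ?case using Suc by linarith
qed simp

theorem mainTheorem2:
  fixes n m k :: nat
  assumes "n \<ge> 1" and "m \<ge> 1" and "k \<in> {0, 1, 2}"
  shows "\<exists>U :: (nat \<Rightarrow> ('a::field_char_0 ^ 4) set) set.
           zariski_open n U \<and> U \<noteq> {} \<and>
           (\<forall>p\<in>U. \<alpha> (points_symbolic_power n p (3 * m - k))
                    \<ge> m * \<alpha> (points_ideal n p) + 2 * m - k)"
proof -
  define a where "a = (LEAST t. n < (t + 3) choose 3)"
  have a: "n < (a + 3) choose 3"
    unfolding a_def by (rule LeastI) (rule less_choose_three)
  have "a \<noteq> 0" using a assms(1) by (intro notI) simp
  then have "\<not> n < (a - 1 + 3) choose 3"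
    unfolding a_def by (intro not_less_Least) simp
  then have a': "(a + 2) choose 3 \<le> n" using \<open>a \<noteq> 0\<close> by simp
  define e where "e = 3 * m - k"
  \<comment> \<open>One less than the claimed bound with \<open>a\<close> in place of
    \<open>\<alpha> (points_ideal n p)\<close>; since \<open>a\<close> bounds that initial degree
    from above, excluding degree \<open>d\<close> suffices.\<close>
  define d where "d = m * (a + 2) - k - 1"
  have k: "k \<le> 2" using assms(3) by auto
  have "2 * m \<ge> 2" "m * a \<ge> 1" using assms(2) \<open>a \<noteq> 0\<close> by auto
  moreover have "m * (a + 2) = m * a + 2 * m" by (simp add: algebra_simps)
  ultimately have d: "d + 1 = m * a + 2 * m - k" using k unfolding d_def by linarith
  \<comment> \<open>Any \<open>a + 2\<close> distinct scalars would do; characteristic zero makes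
    these distinct.\<close>
  define S :: "'a set" where "S = of_nat ` {..<a + 2}"
  have S: "finite S" "card S = a + 2"
    by (simp_all add: S_def card_image inj_on_def)
  \<comment> \<open>The inequality is tight: \<open>m (a - 1) + 3 m - k\<close> equals
    \<open>d + 1\<close>.\<close>
  have "d < m * (card S - 3) + e"
  proof -
    obtain b where b: "a = Suc b" using \<open>a \<noteq> 0\<close> not0_implies_Suc by blast
    show ?thesis using d k assms(2) by (simp add: S e_def b)
  qed
  \<comment> \<open>This is where \<open>k \<le> 2\<close> enters: \<open>e + 3\<close> is
    \<open>3 m + (3 - k)\<close>.\<close>
  moreover have "3 * m < e + 3" "3 \<le> card S" using k assms(2) \<open>a \<noteq> 0\<close> by (auto simp: e_def S)
  ultimately obtain X :: "nat \<Rightarrow> 'a ^ 4" where X: "\<And>j. j < n \<Longrightarrow> X j \<noteq> 0"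
    "\<And>F. homogeneous_of_degree d F \<Longrightarrow>
      (\<And>j y. j < n \<Longrightarrow> line_order e F (\<lambda>v. X j $ v) y) \<Longrightarrow> F = 0"
    using star_configuration_empty[OF S(1), of n m e d] a' S(2) by metis
  obtain U :: "(nat \<Rightarrow> ('a ^ 4) set) set" where U: "zariski_open n U" "U \<noteq> {}"
    "\<And>p F. p \<in> U \<Longrightarrow> F \<in> points_symbolic_power n p e \<Longrightarrow> homogeneous_of_degree d F \<Longrightarrow> F = 0"
    using generic_emptiness[of n X d e] X by blast
  have "\<alpha> (points_symbolic_power n p e) \<ge> m * \<alpha> (points_ideal n p) + 2 * m - k"
    if p: "p \<in> U" for p
  proof -
    have "p \<in> proj_tuples n" using U(1) p by (auto simp: zariski_open_def)
    then obtain F where F: "F \<in> points_ideal n p" "homogeneous_of_degree a F" "F \<noteq> 0"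
      using form_in_points_ideal a by blast
    have "d < \<alpha> (points_symbolic_power n p e)"
    proof (rule initial_degree_greater)
      \<comment> \<open>The power \<open>F ^ e\<close> witnesses that the symbolic power contains a
        nonzero form, so its initial degree is attained.\<close>
      show "F ^ e \<in> points_symbolic_power n p e"
        using F(1) by (auto simp: points_ideal_def points_symbolic_power_def intro: power_in_ideal_power)
      show "homogeneous_of_degree (e * a) (F ^ e)" by (rule homogeneous_of_degree_power) fact
      show "F ^ e \<noteq> 0" using F(3) by simp
      show "0 \<in> points_symbolic_power n p e"
        by (auto simp: points_symbolic_power_def zero_in_ideal_power)
      show "G * H \<in> points_symbolic_power n p e" if "H \<in> points_symbolic_power n p e" for G H
        using that by (auto simp: points_symbolic_power_def intro: ideal_power_mult)
    qed (rule U(3)[OF p])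
    moreover have "m * \<alpha> (points_ideal n p) \<le> m * a"
      using initial_degree_le[OF F] by simp
    ultimately show ?thesis using d by linarith
  qed
  then show ?thesis using U(1,2) unfolding e_def by blast
qed

end
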